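(* For every $a\in\mathcal V^{\mathrm{DR}}$ the following equality holds in $\big(\mathcal M^{\mathrm{DR}}[\tfrac1{e_1}]_{\ge-1}\big)^{\otimes2}$: $$\Delta^{\mathcal M,\mathrm{DR}}(a\cdot1_{\mathrm{DR}})=(e_1f_1)^{-1}\,\mathrm{row}_1\cdot\rho(a)\cdot\mathrm{col}_0 ,$$ where the left-hand side is viewed in this module through the inclusion $(\mathcal M^{\mathrm{DR}})^{\otimes2}\hookrightarrow\big(\mathcal M^{\mathrm{DR}}[\tfrac1{e_1}]_{\ge-1}\big)^{\otimes2}$. Equivalently, the two compositions $$\mathcal V^{\mathrm{DR}}\xrightarrow{\rho}M_3((\mathcal V^{\mathrm{DR}})^{\otimes2})\xrightarrow{(e_1f_1)^{-1}\mathrm{row}_1\cdot(-)\cdot\mathrm{col}_0}\big(\mathcal M^{\mathrm{DR}}[\tfrac1{e_1}]_{\ge-1}\big)^{\otimes2}$$ and $$\mathcal V^{\mathrm{DR}}\xrightarrow{(-)\cdot1_{\mathrm{DR}}}\mathcal M^{\mathrm{DR}}\xrightarrow{\Delta^{\mathcal M,\mathrm{DR}}}(\mathcal M^{\mathrm{DR}})^{\otimes2}\hookrightarrow\big(\mathcal M^{\mathrm{DR}}[\tfrac1{e_1}]_{\ge-1}\big)^{\otimes2}$$ coincide. Moreover all the maps appearing in these compositions have degree $0$.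
   Context: $\mathbf k$ is a commutative $\mathbb Q$-algebra. $\mathcal V^{\mathrm{DR}}:=\mathbf k\langle e_0,e_1\rangle$ is the free associative unital algebra, graded by $\deg e_0=\deg e_1=1$; $e_\infty:=-e_0-e_1$. In $(\mathcal V^{\mathrm{DR}})^{\otimes2}$ one writes $e_i:=e_i\otimes1$, $f_i:=1\otimes e_i$. $\mathcal W^{\mathrm{DR}}:=\mathbf k\oplus\mathcal V^{\mathrm{DR}}e_1$, a subalgebra freely generated by $y_n:=-e_0^{n-1}e_1$ ($n\ge1$). $\Delta^{\mathcal W,\mathrm{DR}}:\mathcal W^{\mathrm{DR}}\to(\mathcal W^{\mathrm{DR}})^{\otimes2}$ is the algebra morphism with $y_n\mapsto y_n\otimes1+1\otimes y_n+\sum_{k=1}^{n-1}y_k\otimes y_{n-k}$. $\mathcal M^{\mathrm{DR}}:=\mathcal V^{\mathrm{DR}}/\mathcal V^{\mathrm{DR}}e_0$ is a graded left $\mathcal V^{\mathrm{DR}}$-module, with $1_{\mathrm{DR}}$ the class of $1$; it is free of rank one over $\mathcal W^{\mathrm{DR}}$ with generator $1_{\mathrm{DR}}$. $\Delta^{\mathcal M,\mathrm{DR}}:\mathcal M^{\mathrm{DR}}\to(\mathcal M^{\mathrm{DR}})^{\otimes2}$ is the $\mathbf k$-linear map with $w\cdot1_{\mathrm{DR}}\mapsto\Delta^{\mathcal W,\mathrm{DR}}(w)\cdot1_{\mathrm{DR}}^{\otimes2}$ for $w\in\mathcal W^{\mathrm{DR}}$. $\mathcal V^{\mathrm{DR}}[\frac1{e_1}]$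 is the $\mathbb Z$-graded algebra with generators $e_0,e_1^{\pm1}$ and relations $e_1e_1^{-1}=e_1^{-1}e_1=1$, and $\mathcal M^{\mathrm{DR}}[\frac1{e_1}]:=\mathcal V^{\mathrm{DR}}[\frac1{e_1}]/\mathcal V^{\mathrm{DR}}[\frac1{e_1}]e_0$, a $\mathbb Z$-graded left $\mathcal V^{\mathrm{DR}}[\frac1{e_1}]$-module, into which $\mathcal M^{\mathrm{DR}}$ injects; the index $\ge-1$ denotes the part of degrees $\ge-1$. $\mathfrak p_5$ is the graded Lie algebra over $\mathbf k$ with generators $e_{ij}$ ($i\ne j\in\{1,\dots,5\}$) of degree 1 and relations $e_{ij}=e_{ji}$, $\sum_{j\ne i}e_{ij}=0$ for each $i$, $[e_{ij},e_{kl}]=0$ for $i,j,k,l$ distinct. The following are algebra morphisms induced by Lie algebra morphisms: $\ell:\mathcal V^{\mathrm{DR}}\to U\mathfrak p_5$, $e_0\mapsto e_{23}$, $e_1\mapsto e_{12}$; and $\mathrm{pr}_1,\mathrm{pr}_2,\mathrm{pr}_5:U\mathfrak p_5\to\mathcal V^{\mathrm{DR}}$ given by: $\mathrm{pr}_1$ kills all $e_{1j}$ and maps $e_{23},e_{45}\mapsto e_0$, $e_{25},e_{34}\mapsto e_1$, $e_{24},e_{35}\mapsto e_\infty$; $\mathrm{pr}_2$ kills all $e_{2j}$ and maps $e_{14},e_{35}\mapsto e_0$, $e_{15},e_{34}\mapsto e_1$, $e_{13},e_{45}\mapsto e_\infty$; $\mathrm{pr}_5$ kills all $e_{j5}$ and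 maps $e_{14},e_{23}\mapsto e_0$, $e_{12},e_{34}\mapsto e_1$, $e_{13},e_{24}\mapsto e_\infty$. $\mathrm{pr}_{12}:U\mathfrak p_5\to(\mathcal V^{\mathrm{DR}})^{\otimes2}$ is the algebra morphism with $x\mapsto\mathrm{pr}_1(x)\otimes1+1\otimes\mathrm{pr}_2(x)$ for $x\in\mathfrak p_5$. The two-sided ideal $J(\mathrm{pr}_5):=\mathrm{Ker}(\mathrm{pr}_5)$ of $U\mathfrak p_5$ is free as a left $U\mathfrak p_5$-module with basis $(e_{15},e_{25},e_{35})$; hence for $p\in U\mathfrak p_5$ there is a unique matrix $\varpi(p)=(a_{ij}(p))_{1\le i,j\le3}$ with $e_{i5}p=\sum_{j=1}^3a_{ij}(p)e_{j5}$ for $i=1,2,3$, and $\varpi:U\mathfrak p_5\to M_3(U\mathfrak p_5)$ is an algebra morphism. The algebra morphism $\rho:\mathcal V^{\mathrm{DR}}\to M_3((\mathcal V^{\mathrm{DR}})^{\otimes2})$ is $\rho:=M_3(\mathrm{pr}_{12})\circ\varpi\circ\ell$, where $M_3(\mathrm{pr}_{12})$ applies $\mathrm{pr}_{12}$ entrywise. Finally $$\mathrm{row}_1:=\begin{pmatrix} e_1 & -f_1 & 0 \end{pmatrix}\in M_{1\times3}((\mathcal V^{\mathrm{DR}})^{\otimes2}),\qquad\mathrm{col}_0:=\begin{pmatrix} 0 \\ -e_1\cdot1_{\mathrm{DR}}^{\otimes2} \\ e_1\cdot1_{\mathrm{DR}}^{\otimes2} \end{pmatrix}\in M_{3\times1}((\mathcal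 M^{\mathrm{DR}})^{\otimes2}).$$ The map $(e_1f_1)^{-1}\mathrm{row}_1\cdot(-)\cdot\mathrm{col}_0:M_3((\mathcal V^{\mathrm{DR}})^{\otimes2})\to\mathcal M^{\mathrm{DR}}[\frac1{e_1}]^{\otimes2}$ is $m\mapsto(e_1f_1)^{-1}\,\mathrm{row}_1\,m\,\mathrm{col}_0$, formed with the product of $\mathcal V^{\mathrm{DR}}[\frac1{e_1}]^{\otimes2}$ and its action on $\mathcal M^{\mathrm{DR}}[\frac1{e_1}]^{\otimes2}$; its image is contained in $(\mathcal M^{\mathrm{DR}}[\frac1{e_1}]_{\ge-1})^{\otimes2}$. *)

theory Defs
  imports "HOL-Library.Poly_Mapping" "HOL-Library.Product_Plus" "HOL-Analysis.Cartesian_Space"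
begin

section \<open>Monoid algebras\<close>

text \<open>
  For an (additively written, not necessarily commutative) monoid \<open>'m\<close>, the type
  \<open>'m \<Rightarrow>\<^sub>0 'k\<close> with its library multiplication is the monoid algebra \<open>k['m]\<close>.  The free
  algebra is the case of the free monoid, and \<open>k['m] \<otimes> k['n] = k['m \<times> 'n]\<close>, see
  \<open>tens_universal\<close> below.
\<close>

datatype 'g word = Word (letters: "'g list")

instantiation word :: (type) monoid_add
begin
definition zero_word :: "'a word" where "zero_word = Word []"
definition plus_word :: "'a word \<Rightarrow> 'a word \<Rightarrow> 'a word"
  where "plus_word u v = Word (letters u @ letters v)"
instance by standard (auto simp: zero_word_def plus_word_def)
end

abbreviation mon :: "'m \<Rightarrow> 'm \<Rightarrow>\<^sub>0 'k::zero_neq_one" where "mon w \<equiv> Poly_Mapping.single w 1"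

abbreviation cst :: "'k \<Rightarrow> 'm::monoid_add \<Rightarrow>\<^sub>0 'k::comm_ring_1"
  where "cst c \<equiv> Poly_Mapping.single 0 c"

definition ring_hom :: "('a::ring_1 \<Rightarrow> 'b::ring_1) \<Rightarrow> bool"
  where "ring_hom f \<longleftrightarrow> f 1 = 1 \<and> (\<forall>x y. f (x + y) = f x + f y) \<and> (\<forall>x y. f (x * y) = f x * f y)"

lemma ring_hom_simps:
  assumes "ring_hom f"
  shows "f 1 = 1" "f (x + y) = f x + f y" "f (x * y) = f x * f y" "f 0 = 0" "f (- x) = - f x"
    "f (x - y) = f x - f y"
proof -
  show 1: "f 1 = 1" "f (x + y) = f x + f y" "f (x * y) = f x * f y"
    using assms by (auto simp: ring_hom_def)
  have a: "f (x + y) = f x + f y" for x y using assms by (auto simp: ring_hom_def)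
  show 0: "f 0 = 0" using a[of 0 0] by simp
  have m: "f (- x) = - f x" for x using a[of x "- x"] 0 by (simp add: eq_neg_iff_add_eq_0 add.commute)
  show "f (- x) = - f x" by (rule m)
  show "f (x - y) = f x - f y" using a[of x "- y"] m[of y] by simp
qed

text \<open>
  The algebra morphism out of a monoid algebra that extends the monoid morphism \<open>h\<close>; \<open>\<eta>\<close> is the
  structure morphism of the target algebra.
\<close>
definition mlift :: "('k::comm_ring_1 \<Rightarrow> 'a::ring_1) \<Rightarrow> ('m \<Rightarrow> 'a) \<Rightarrow> ('m \<Rightarrow>\<^sub>0 'k) \<Rightarrow> 'a"
  where "mlift \<eta> h x = (\<Sum>w\<in>Poly_Mapping.keys x. \<eta> (Poly_Mapping.lookup x w) * h w)"

definition word_prod :: "('g \<Rightarrow> 'a::ring_1) \<Rightarrow> 'g word \<Rightarrow> 'a"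
  where "word_prod f w = prod_list (map f (letters w))"

definition mon_map :: "('m \<Rightarrow> 'n::monoid_add) \<Rightarrow> ('m \<Rightarrow>\<^sub>0 'k) \<Rightarrow> 'n \<Rightarrow>\<^sub>0 'k::comm_ring_1"
  where "mon_map h = mlift cst (\<lambda>w. mon (h w))"

lemma poly_mapping_add_induct [case_names zero single add]:
  assumes "P 0" "\<And>w c. P (Poly_Mapping.single w c)" "\<And>x y. P x \<Longrightarrow> P y \<Longrightarrow> P (x + y)"
  shows "P (x :: 'm \<Rightarrow>\<^sub>0 'k::comm_ring_1)"
proof (induction x rule: update_induct)
  case const
  show ?case by (rule assms(1))
next
  case (update f a b)
  have "Poly_Mapping.update a b f = f + Poly_Mapping.single a b"
    by (rule poly_mapping_eqI)
      (use update(1) in \<open>auto simp: lookup_update lookup_add lookup_single when_def in_keys_iff\<close>)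
  then show ?case using assms(2,3) update by simp
qed

lemma mlift_add:
  assumes "ring_hom \<eta>"
  shows "mlift \<eta> h (x + y) = mlift \<eta> h x + mlift \<eta> h y"
proof -
  let ?K = "Poly_Mapping.keys x \<union> Poly_Mapping.keys y"
  have *: "mlift \<eta> h z = (\<Sum>w\<in>?K. \<eta> (Poly_Mapping.lookup z w) * h w)"
    if "Poly_Mapping.keys z \<subseteq> ?K" for z
    unfolding mlift_def using that
    by (intro sum.mono_neutral_left) (auto simp: in_keys_iff ring_hom_simps[OF assms])
  show ?thesis
    using *[of x] *[of y] *[of "x + y"] keys_add[of x y]
    by (simp add: lookup_add ring_hom_simps[OF assms] distrib_right sum.distrib)
qed

lemma mlift_zero: "mlift \<eta> h 0 = 0"
  by (simp add: mlift_def)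

lemma mlift_single:
  assumes "ring_hom \<eta>"
  shows "mlift \<eta> h (Poly_Mapping.single w c) = \<eta> c * h w"
  by (cases "c = 0") (auto simp: mlift_def ring_hom_simps[OF assms])

lemma ring_hom_mlift:
  assumes \<eta>: "ring_hom \<eta>" and central: "\<And>c a. \<eta> c * a = a * \<eta> c"
    and h: "h 0 = 1" "\<And>u v. h (u + v) = h u * h v"
  shows "ring_hom (mlift \<eta> h)"
proof -
  have 1: "mlift \<eta> h (Poly_Mapping.single u a * y) = mlift \<eta> h (Poly_Mapping.single u a) * mlift \<eta> h y"
    for u a y
  proof (induction y rule: poly_mapping_add_induct)
    case (single v b)
    have "\<eta> (a * b) * h (u + v) = \<eta> a * (\<eta> b * h u) * h v"
      by (simp add: h ring_hom_simps[OF \<eta>] mult.assoc)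
    also have "\<dots> = \<eta> a * h u * (\<eta> b * h v)"
      by (simp add: central[of b "h u"] mult.assoc)
    finally show ?case by (simp add: mult_single mlift_single[OF \<eta>])
  qed (auto simp: mlift_zero distrib_left mlift_add[OF \<eta>])
  have 2: "mlift \<eta> h (x * y) = mlift \<eta> h x * mlift \<eta> h y" for x y
    by (induction x rule: poly_mapping_add_induct)
      (auto simp: mlift_zero distrib_right mlift_add[OF \<eta>] 1)
  have "mlift \<eta> h 1 = 1"
    using mlift_single[OF \<eta>, of h 0 1] by (simp add: h ring_hom_simps[OF \<eta>])
  with 2 show ?thesis by (auto simp: ring_hom_def mlift_add[OF \<eta>])
qed

lemma word_prod_simps: "word_prod f 0 = 1" "word_prod f (u + v) = word_prod f u * word_prod f v"
  by (auto simp: word_prod_def zero_word_def plus_word_def)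

lemma ring_hom_cst: "ring_hom (cst :: 'k \<Rightarrow> 'm::monoid_add \<Rightarrow>\<^sub>0 'k::comm_ring_1)"
  by (auto simp: ring_hom_def single_add mult_single)

lemma cst_central: "cst c * x = x * cst c"
  by (induction x rule: poly_mapping_add_induct) (auto simp: mult_single mult.commute distrib_left distrib_right)

lemma ring_hom_mlift_cst:
  assumes "h 0 = 1" "\<And>u v. h (u + v) = h u * h v"
  shows "ring_hom (mlift cst h)"
  using ring_hom_mlift[OF ring_hom_cst cst_central] assms by blast

lemma mon_map_single [simp]: "mon_map h (Poly_Mapping.single w c) = Poly_Mapping.single (h w) c"
  by (simp add: mon_map_def mlift_single[OF ring_hom_cst] mult_single)

lemma mon_map_add: "mon_map h (x + y) = mon_map h x + mon_map h y"
  by (simp add: mon_map_def mlift_add[OF ring_hom_cst])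

lemma ring_hom_mon_map:
  assumes "h 0 = 0" "\<And>u v. h (u + v) = h u + h v"
  shows "ring_hom (mon_map h)"
  unfolding mon_map_def using assms by (intro ring_hom_mlift_cst) (auto simp: mult_single)

definition inl :: "('m::monoid_add \<Rightarrow>\<^sub>0 'k) \<Rightarrow> ('m \<times> 'n::monoid_add) \<Rightarrow>\<^sub>0 'k::comm_ring_1"
  where "inl = mon_map (\<lambda>u. (u, 0))"

definition inr :: "('n::monoid_add \<Rightarrow>\<^sub>0 'k) \<Rightarrow> ('m::monoid_add \<times> 'n) \<Rightarrow>\<^sub>0 'k::comm_ring_1"
  where "inr = mon_map (\<lambda>v. (0, v))"

definition tens :: "('m::monoid_add \<Rightarrow>\<^sub>0 'k) \<Rightarrow> ('n::monoid_add \<Rightarrow>\<^sub>0 'k) \<Rightarrow> ('m \<times> 'n) \<Rightarrow>\<^sub>0 'k::comm_ring_1"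
  where "tens x y = inl x * inr y"

lemma ring_hom_inl: "ring_hom inl" and ring_hom_inr: "ring_hom inr"
  unfolding inl_def inr_def by (auto intro!: ring_hom_mon_map simp: zero_prod_def)

lemma inl_inr_commute: "inl x * inr y = inr y * inl x"
proof (induction x rule: poly_mapping_add_induct)
  case zero
  show ?case by (simp add: ring_hom_simps[OF ring_hom_inl])
next
  case (single u a)
  show ?case
    by (induction y rule: poly_mapping_add_induct)
      (auto simp: ring_hom_simps[OF ring_hom_inr] distrib_left distrib_right,
        auto simp: inl_def inr_def mult_single mult.commute)
next
  case (add x y)
  then show ?case by (simp add: ring_hom_simps[OF ring_hom_inl] distrib_left distrib_right)
qed

lemma tens_single: "tens (Poly_Mapping.single u a) (Poly_Mapping.single v b) = Poly_Mapping.single (u, v) (a * b)"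
  by (simp add: tens_def inl_def inr_def mult_single)

lemma tens_add: "tens (x + x') y = tens x y + tens x' y" "tens x (y + y') = tens x y + tens x y'"
  by (auto simp: tens_def ring_hom_simps[OF ring_hom_inl] ring_hom_simps[OF ring_hom_inr] distrib_left distrib_right)

lemma tens_mult: "tens x y * tens x' y' = tens (x * x') (y * y')"
proof -
  have "tens x y * tens x' y' = inl x * (inr y * inl x') * inr y'"
    by (simp add: tens_def mult.assoc)
  also have "\<dots> = inl x * (inl x' * inr y) * inr y'"
    by (simp only: inl_inr_commute)
  also have "\<dots> = tens (x * x') (y * y')"
    by (simp add: tens_def mult.assoc ring_hom_simps[OF ring_hom_inl] ring_hom_simps[OF ring_hom_inr])
  finally show ?thesis .
qed

lemma tens_cst: "tens (cst c * x) y = cst c * tens x y" "tens x (cst c * y) = cst c * tens x y"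
proof -
  have *: "inl (cst c) = cst c" "inr (cst c) = cst c" for c
    by (auto simp: inl_def inr_def zero_prod_def)
  show "tens (cst c * x) y = cst c * tens x y"
    by (simp add: tens_def ring_hom_simps[OF ring_hom_inl] mult.assoc *)
  show "tens x (cst c * y) = cst c * tens x y"
    unfolding tens_def ring_hom_simps(3)[OF ring_hom_inr] *
    by (simp only: mult.assoc[symmetric] cst_central[of c "inl x"])
qed


lemma module_monoid_algebra: "module (\<lambda>(c::'k::comm_ring_1) (x :: 'm::monoid_add \<Rightarrow>\<^sub>0 'k). cst c * x)"
  by standard (simp_all add: distrib_left distrib_right single_add mult.assoc[symmetric] mult_single)

lemma lin_ext_exists:
  fixes s :: "'k::comm_ring_1 \<Rightarrow> 'c::ab_group_add \<Rightarrow> 'c" and g :: "'m::monoid_add \<Rightarrow> 'c"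
  assumes "module s"
  obtains L where "module_hom (\<lambda>c x. cst c * x) s L" "\<And>w c. L (Poly_Mapping.single w c) = s c (g w)"
proof -
  interpret module s by fact
  define L where "L x = (\<Sum>w\<in>Poly_Mapping.keys x. s (Poly_Mapping.lookup x w) (g w))" for x
  have single: "L (Poly_Mapping.single w c) = s c (g w)" for w c
    by (cases "c = 0") (auto simp: L_def)
  have add: "L (x + y) = L x + L y" for x y
  proof -
    let ?K = "Poly_Mapping.keys x \<union> Poly_Mapping.keys y"
    have *: "L z = (\<Sum>w\<in>?K. s (Poly_Mapping.lookup z w) (g w))"
      if "Poly_Mapping.keys z \<subseteq> ?K" for z
      unfolding L_def using that by (intro sum.mono_neutral_left) (auto simp: in_keys_iff)
    show ?thesis
      using *[of x] *[of y] *[of "x + y"] keys_add[of x y]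
      by (simp add: lookup_add scale_left_distrib sum.distrib)
  qed
  have zero: "L 0 = 0" by (simp add: L_def)
  have scale: "L (cst c * x) = s c (L x)" for c x
    by (induction x rule: poly_mapping_add_induct)
      (auto simp: zero distrib_left add mult_single single scale_right_distrib)
  interpret A: module "\<lambda>c (x :: 'm \<Rightarrow>\<^sub>0 'k). cst c * x" by (rule module_monoid_algebra)
  have "module_hom (\<lambda>c x. cst c * x) s L"
    by unfold_locales (auto simp: add scale)
  with single that show thesis by blast
qed

text \<open>\<open>k['m \<times> 'n]\<close> with \<open>tens\<close> is the tensor product of the modules \<open>k['m]\<close> and \<open>k['n]\<close>.\<close>

lemma tens_universal:
  fixes s :: "'k::comm_ring_1 \<Rightarrow> 'c::ab_group_add \<Rightarrow> 'c"
    and B :: "('m::monoid_add \<Rightarrow>\<^sub>0 'k) \<Rightarrow> ('n::monoid_add \<Rightarrow>\<^sub>0 'k) \<Rightarrow> 'c"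
  assumes s: "module s"
    and B1: "\<And>y. module_hom (\<lambda>c x. cst c * x) s (\<lambda>x. B x y)"
    and B2: "\<And>x. module_hom (\<lambda>c y. cst c * y) s (\<lambda>y. B x y)"
  shows "\<exists>!L. module_hom (\<lambda>c z. cst c * z) s L \<and> (\<forall>x y. L (tens x y) = B x y)"
proof -
  interpret module s by fact
  note B1' = module_hom.add[OF B1] module_hom.scale[OF B1]
  note B2' = module_hom.add[OF B2] module_hom.scale[OF B2]
  have B0: "B 0 y = 0" "B x 0 = 0" for x y
    using B1'(1)[of 0 0 y] B2'(1)[of x 0 0] by auto
  obtain L :: "('m \<times> 'n \<Rightarrow>\<^sub>0 'k) \<Rightarrow> 'c" where L: "module_hom (\<lambda>c x. cst c * x) s L"
    "\<And>w c. L (Poly_Mapping.single w c) = s c (case w of (u, v) \<Rightarrow> B (mon u) (mon v))"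
    using lin_ext_exists[OF s, of "\<lambda>(u, v). B (mon u) (mon v)"] by blast
  note La = module_hom.add[OF L(1)]
  have L0: "L 0 = 0" using La[of 0 0] by simp
  have t0: "tens 0 y = 0" "tens x 0 = 0" for x :: "'m \<Rightarrow>\<^sub>0 'k" and y :: "'n \<Rightarrow>\<^sub>0 'k"
    using tens_add(1)[of 0 0 y] tens_add(2)[of x 0 0] by auto
  have sg: "B (Poly_Mapping.single u a) (Poly_Mapping.single v b) = s (a * b) (B (mon u) (mon v))" for u v a b
  proof -
    have "B (cst a * mon u) (cst b * mon v) = s (a * b) (B (mon u) (mon v))"
      unfolding B1'(2) B2'(2) scale_scale mult.commute[of a b] by (rule refl)
    then show ?thesis by (simp only: mult_single add_0 mult_1_right)
  qed
  have Lsg: "L (tens (Poly_Mapping.single u a) (Poly_Mapping.single v b))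
      = B (Poly_Mapping.single u a) (Poly_Mapping.single v b)" for u v a b
    by (simp only: tens_single L(2) prod.case sg[symmetric])
  have LB: "L (tens x y) = B x y" for x y
  proof (induction x rule: poly_mapping_add_induct)
    case (single u a)
    show ?case
      by (induction y rule: poly_mapping_add_induct) (auto simp: t0 B0 L0 Lsg tens_add La B2'(1))
  qed (auto simp: t0 B0 L0 tens_add La B1'(1))
  have "L' = L" if L': "module_hom (\<lambda>c z. cst c * z) s L'" "\<forall>x y. L' (tens x y) = B x y" for L'
  proof
    fix z
    show "L' z = L z"
    proof (induction z rule: poly_mapping_add_induct)
      case zero
      show ?case using L0 module_hom.add[OF L'(1), of 0 0] by simp
    next
      case (single w c)
      obtain u v where w: "w = (u, v)" by (cases w)
      show ?case
        using LB[of "Poly_Mapping.single u c" "mon v"] L'(2)[rule_format, of "Poly_Mapping.single u c" "mon v"]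
        by (simp add: w tens_single)
    next
      case (add x y)
      then show ?case by (simp add: La module_hom.add[OF L'(1)])
    qed
  qed
  with L(1) LB show ?thesis by blast
qed


section \<open>Cyclic left modules over monoid algebras and their tensor products\<close>

inductive_set left_ideal :: "'a::ring_1 set \<Rightarrow> 'a set" for S where
  left_ideal_gen: "x \<in> S \<Longrightarrow> x \<in> left_ideal S"
| left_ideal_zero: "0 \<in> left_ideal S"
| left_ideal_add: "x \<in> left_ideal S \<Longrightarrow> y \<in> left_ideal S \<Longrightarrow> x + y \<in> left_ideal S"
| left_ideal_mult: "x \<in> left_ideal S \<Longrightarrow> a * x \<in> left_ideal S"

lemma left_ideal_diff: "x \<in> left_ideal S \<Longrightarrow> y \<in> left_ideal S \<Longrightarrow> x - y \<in> left_ideal S"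
  using left_ideal_add[of x S "- 1 * y"] left_ideal_mult[of y S "- 1"] by simp

text \<open>
  \<open>('m, 'k) lquot\<close> is \<open>A / (\<Sum>\<^bsub>s \<in> ann\<^esub> A s)\<close> for \<open>A = k['m]\<close>.  On a product, \<open>ann\<close> is chosen such that
  \<open>('m \<times> 'n, 'k) lquot\<close> is the tensor product of \<open>('m, 'k) lquot\<close> and \<open>('n, 'k) lquot\<close>,
  see \<open>qtens_universal\<close> below.
\<close>
class with_ann = monoid_add +
  fixes ann :: "'a set"

instantiation prod :: (with_ann, with_ann) with_ann
begin
definition ann_prod :: "('a \<times> 'b) set"
  where "ann_prod = (\<lambda>s. (s, 0)) ` ann \<union> (\<lambda>s. (0, s)) ` ann"
instance ..
end

lifting_forget poly_mapping.lifting

abbreviation annI :: "('m::with_ann \<Rightarrow>\<^sub>0 'k::comm_ring_1) set" where "annI \<equiv> left_ideal (mon ` ann)"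

quotient_type (overloaded) ('m, 'k) lquot = "'m::with_ann \<Rightarrow>\<^sub>0 'k::comm_ring_1"
  / "\<lambda>x y. x - y \<in> annI"
proof (rule equivpI)
  show "reflp (\<lambda>x y :: 'm \<Rightarrow>\<^sub>0 'k. x - y \<in> annI)"
    by (rule reflpI) (simp add: left_ideal_zero)
  show "symp (\<lambda>x y :: 'm \<Rightarrow>\<^sub>0 'k. x - y \<in> annI)"
  proof (rule sympI)
    fix x y :: "'m \<Rightarrow>\<^sub>0 'k" assume "x - y \<in> annI"
    then show "y - x \<in> annI" using left_ideal_mult[of "x - y" _ "- 1"] by simp
  qed
  show "transp (\<lambda>x y :: 'm \<Rightarrow>\<^sub>0 'k. x - y \<in> annI)"
  proof (rule transpI)
    fix x y z :: "'m \<Rightarrow>\<^sub>0 'k" assume "x - y \<in> annI" "y - z \<in> annI"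
    then show "x - z \<in> annI" using left_ideal_add[of "x - y" _ "y - z"] by simp
  qed
qed

instantiation lquot :: (with_ann, comm_ring_1) ab_group_add
begin
lift_definition zero_lquot :: "('a, 'b) lquot" is 0 .
lift_definition plus_lquot :: "('a, 'b) lquot \<Rightarrow> ('a, 'b) lquot \<Rightarrow> ('a, 'b) lquot" is "(+)"
  by (simp only: add_diff_add left_ideal_add)
lift_definition uminus_lquot :: "('a, 'b) lquot \<Rightarrow> ('a, 'b) lquot" is uminus
proof -
  fix x y :: "'a \<Rightarrow>\<^sub>0 'b" assume "x - y \<in> annI"
  then show "- x - - y \<in> annI" using left_ideal_mult[of "x - y" _ "- 1"] by simp
qed
lift_definition minus_lquot :: "('a, 'b) lquot \<Rightarrow> ('a, 'b) lquot \<Rightarrow> ('a, 'b) lquot" is "(-)"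
proof -
  fix x y x' y' :: "'a \<Rightarrow>\<^sub>0 'b" assume "x - y \<in> annI" "x' - y' \<in> annI"
  then have "(x - y) - (x' - y') \<in> annI" by (rule left_ideal_diff)
  then show "x - x' - (y - y') \<in> annI" by (simp add: algebra_simps)
qed
instance
  by standard (transfer; simp add: left_ideal_zero algebra_simps)+
end

lift_definition act :: "('m::with_ann \<Rightarrow>\<^sub>0 'k::comm_ring_1) \<Rightarrow> ('m, 'k) lquot \<Rightarrow> ('m, 'k) lquot" (infixr \<open>\<rhd>\<close> 75)
  is "(*)"
  by (simp only: left_ideal_mult right_diff_distrib[symmetric])

lift_definition qclass :: "('m::with_ann \<Rightarrow>\<^sub>0 'k::comm_ring_1) \<Rightarrow> ('m, 'k) lquot" is "\<lambda>x. x" .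

definition qscale :: "'k::comm_ring_1 \<Rightarrow> ('m::with_ann, 'k) lquot \<Rightarrow> ('m, 'k) lquot"
  where "qscale c m = cst c \<rhd> m"

lemma act_simps:
  "(a + b) \<rhd> m = a \<rhd> m + b \<rhd> m" "a \<rhd> (m + n) = a \<rhd> m + a \<rhd> n" "(a * b) \<rhd> m = a \<rhd> b \<rhd> m" "1 \<rhd> m = m"
  by (transfer; simp add: left_ideal_zero algebra_simps)+

lemma module_qscale: "module qscale"
  by standard (simp_all add: qscale_def act_simps single_add act_simps(3)[symmetric] mult_single)

lemma qclass_simps:
  "qclass (x + y) = qclass x + qclass y" "qclass (a * x) = a \<rhd> qclass x"
  "qclass (cst c * x) = qscale c (qclass x)"
  unfolding qscale_def by (transfer; simp add: left_ideal_zero)+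

lemma qclass_surj: "\<exists>x. m = qclass x"
  by transfer (use left_ideal_zero in \<open>metis diff_self\<close>)

lemma qclass_eq_iff: "qclass x = qclass y \<longleftrightarrow> x - y \<in> annI"
  by transfer simp

lemma qclass_killed:
  assumes "t \<in> ann"
  shows "qclass (a * mon t) = 0"
  using assms by transfer (simp, intro left_ideal_mult left_ideal_gen imageI)

lemma tens_left_ideal:
  assumes "z \<in> annI"
  shows "tens z y \<in> annI" "tens x z \<in> annI"
proof -
  show "tens z y \<in> annI"
    using assms
  proof induction
    case (left_ideal_gen z)
    then obtain s where s: "s \<in> ann" "z = mon s" by auto
    have "inl z \<in> annI"
      using s by (auto simp: inl_def ann_prod_def intro!: left_ideal.left_ideal_gen)
    then show ?case
      unfolding tens_def inl_inr_commute by (rule left_ideal_mult)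
  next
    case (left_ideal_mult z a)
    then have "inl a * tens z y \<in> annI" by (intro left_ideal.left_ideal_mult)
    then show ?case by (simp add: tens_def ring_hom_simps[OF ring_hom_inl] mult.assoc)
  next
    case (left_ideal_add z z')
    then show ?case by (simp only: tens_add left_ideal.left_ideal_add)
  qed (simp add: tens_def ring_hom_simps(4)[OF ring_hom_inl] left_ideal.left_ideal_zero)
  show "tens x z \<in> annI"
    using assms
  proof induction
    case (left_ideal_gen z)
    then obtain s where s: "s \<in> ann" "z = mon s" by auto
    have "inr z \<in> annI"
      using s by (auto simp: inr_def ann_prod_def intro!: left_ideal.left_ideal_gen)
    then show ?case
      unfolding tens_def by (rule left_ideal_mult)
  next
    case (left_ideal_mult z a)
    then have "inr a * tens x z \<in> annI" by (intro left_ideal.left_ideal_mult)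
    also have "inr a * tens x z = tens x (a * z)"
      by (simp add: tens_def ring_hom_simps(3)[OF ring_hom_inr] mult.assoc[symmetric] inl_inr_commute[symmetric])
    finally show ?case .
  next
    case (left_ideal_add z z')
    then show ?case by (simp only: tens_add left_ideal.left_ideal_add)
  qed (simp add: tens_def ring_hom_simps(4)[OF ring_hom_inr] left_ideal.left_ideal_zero)
qed

lift_definition qtens :: "('m::with_ann, 'k::comm_ring_1) lquot \<Rightarrow> ('n::with_ann, 'k) lquot \<Rightarrow> ('m \<times> 'n, 'k) lquot"
  is tens
proof -
  fix x x' :: "'m \<Rightarrow>\<^sub>0 'k" and y y' :: "'n \<Rightarrow>\<^sub>0 'k"
  assume "x - x' \<in> annI" "y - y' \<in> annI"
  then have "tens (x - x') y + tens x' (y - y') \<in> annI"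
    by (intro left_ideal_add tens_left_ideal)
  also have "tens (x - x') y + tens x' (y - y') = tens x y - tens x' y'"
    by (simp add: tens_def ring_hom_simps[OF ring_hom_inl] ring_hom_simps[OF ring_hom_inr] algebra_simps)
  finally show "tens x y - tens x' y' \<in> annI" .
qed

lemma qtens_universal:
  fixes s :: "'k::comm_ring_1 \<Rightarrow> 'c::ab_group_add \<Rightarrow> 'c"
    and B :: "('m::with_ann, 'k) lquot \<Rightarrow> ('n::with_ann, 'k) lquot \<Rightarrow> 'c"
  assumes s: "module s"
    and B1: "\<And>y. module_hom qscale s (\<lambda>x. B x y)"
    and B2: "\<And>x. module_hom qscale s (\<lambda>y. B x y)"
  shows "\<exists>!L. module_hom qscale s L \<and> (\<forall>x y. L (qtens x y) = B x y)"
proof -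
  interpret module s by fact
  note qc = qclass_simps(1,3) and qsurj = qclass_surj and killed = qclass_killed
  have qt: "qtens (qclass x) (qclass y) = qclass (tens x y)" for x :: "'m \<Rightarrow>\<^sub>0 'k" and y :: "'n \<Rightarrow>\<^sub>0 'k"
    by transfer (simp add: left_ideal_zero)
  have hom_qc: "module_hom (\<lambda>c x. cst c * x) s (\<lambda>x. f (qclass x))"
    if "module_hom qscale s f" for f :: "('o::with_ann, 'k) lquot \<Rightarrow> 'c"
    using that s module_monoid_algebra
    unfolding module_hom_iff qc(1,2) by blast
  define B' where "B' x y = B (qclass x) (qclass y)" for x y
  have "\<exists>!L. module_hom (\<lambda>c z. cst c * z) s L \<and> (\<forall>x y. L (tens x y) = B' x y)"
    unfolding B'_def by (intro tens_universal s hom_qc B1 B2)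
  then obtain L where L: "module_hom (\<lambda>c z. cst c * z) s L" "\<And>x y. L (tens x y) = B' x y"
    and L_unique: "\<And>L'. module_hom (\<lambda>c z. cst c * z) s L' \<Longrightarrow> (\<forall>x y. L' (tens x y) = B' x y) \<Longrightarrow> L' = L"
    by (metis (no_types, lifting))
  note La = module_hom.add[OF L(1)]
  have L0: "L 0 = 0" using La[of 0 0] by simp
  have B0: "B 0 y = 0" "B x 0 = 0" for x y
    using module_hom.add[OF B1, of 0 0 y] module_hom.add[OF B2, of x 0 0] by auto
  have kill: "L (z * mon t) = 0" if t: "t \<in> ann" for t z
  proof (induction z rule: poly_mapping_add_induct)
    case (single w c)
    obtain u v where w: "w = (u, v)" by (cases w)
    from t consider (1) t1 where "t = (t1, 0)" "t1 \<in> ann" | (2) t2 where "t = (0, t2)" "t2 \<in> ann"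
      by (auto simp: ann_prod_def)
    then show ?case
    proof cases
      case 1
      have "Poly_Mapping.single w c * mon t = tens (Poly_Mapping.single u c * mon t1) (mon v)"
        by (simp add: w 1 mult_single tens_single)
      then show ?thesis by (simp only: L(2) B'_def killed[OF 1(2)] B0)
    next
      case 2
      have "Poly_Mapping.single w c * mon t = tens (mon u) (Poly_Mapping.single v c * mon t2)"
        by (simp add: w 2 mult_single tens_single)
      then show ?thesis by (simp only: L(2) B'_def killed[OF 2(2)] B0)
    qed
  qed (auto simp: L0 distrib_right La)
  have "L (a * z) = 0" if "z \<in> annI" for z a
    using that
    by (induction arbitrary: a) (auto simp: kill L0 distrib_left La mult.assoc[symmetric])
  from this[of _ 1] have L_ann: "L z = 0" if "z \<in> annI" for z using that by simp
  have L_eq: "L x = L y" if "qclass x = qclass y" for x y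
  proof -
    from that have "x - y \<in> annI" by (simp add: qclass_eq_iff)
    then have "L (x - y) = 0" by (rule L_ann)
    moreover have "L x = L (x - y) + L y" using La[of "x - y" y] by simp
    ultimately show ?thesis by simp
  qed
  define L1 where "L1 m = L (SOME x. m = qclass x)" for m
  have L1: "L1 (qclass x) = L x" for x
    unfolding L1_def by (rule L_eq) (metis (mono_tags, lifting) someI_ex)
  have "module_hom qscale s L1"
    unfolding module_hom_iff
    by (intro conjI allI s module_qscale)
      (metis L1 La qc(1) qsurj, metis L1 module_hom.scale[OF L(1)] qc(2) qsurj)
  moreover have "L1 (qtens x y) = B x y" for x y
    using qsurj[of x] qsurj[of y] by (auto simp: qt L1 L(2) B'_def)
  moreover have "L' = L1"
    if "module_hom qscale s L'" "\<forall>x y. L' (qtens x y) = B x y" for L'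
  proof -
    have "(\<lambda>x. L' (qclass x)) = L"
      by (rule L_unique) (use that in \<open>auto simp: hom_qc B'_def qt[symmetric]\<close>)
    then have "L' (qclass x) = L1 (qclass x)" for x
      unfolding L1 by (rule fun_cong)
    then show ?thesis
      using qsurj by (metis (no_types) ext)
  qed
  ultimately show ?thesis by blast
qed


lemma mon_map_left_ideal:
  assumes h: "h 0 = 0" "\<And>u v. h (u + v) = h u + h v" "h ` ann \<subseteq> ann" and z: "z \<in> annI"
  shows "mon_map h z \<in> annI"
  using z
proof induction
  case (left_ideal_gen z)
  then obtain s where "s \<in> ann" "z = mon s" by auto
  then show ?case using h(3) by (auto intro!: left_ideal.left_ideal_gen)
next
  case (left_ideal_mult z a)
  then show ?case
    by (simp only: ring_hom_simps(3)[OF ring_hom_mon_map[OF h(1,2)]] left_ideal.left_ideal_mult)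
next
  case (left_ideal_add z z')
  then show ?case by (simp only: mon_map_add left_ideal.left_ideal_add)
qed (simp add: ring_hom_simps(4)[OF ring_hom_mon_map[OF h(1,2)]] left_ideal.left_ideal_zero)


section \<open>Gradings\<close>

class graded_monoid = monoid_add +
  fixes mdeg :: "'a \<Rightarrow> int"
  assumes mdeg_zero: "mdeg 0 = 0" and mdeg_add: "mdeg (x + y) = mdeg x + mdeg y"

instantiation prod :: (graded_monoid, graded_monoid) graded_monoid
begin
definition mdeg_prod :: "'a \<times> 'b \<Rightarrow> int" where "mdeg_prod p = mdeg (fst p) + mdeg (snd p)"
instance by standard (auto simp: mdeg_prod_def mdeg_zero mdeg_add)
end

instantiation word :: (type) graded_monoid
begin
definition mdeg_word :: "'a word \<Rightarrow> int" where "mdeg_word w = int (length (letters w))"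
instance by standard (auto simp: mdeg_word_def zero_word_def plus_word_def)
end

definition deg_part :: "int \<Rightarrow> ('m::graded_monoid \<Rightarrow>\<^sub>0 'k::comm_ring_1) set"
  where "deg_part n = {x. \<forall>w\<in>Poly_Mapping.keys x. mdeg w = n}"

definition qdeg_part :: "int \<Rightarrow> ('m::{with_ann,graded_monoid}, 'k::comm_ring_1) lquot set"
  where "qdeg_part n = qclass ` deg_part n"

definition mat_deg_part :: "int \<Rightarrow> (('m::graded_monoid \<Rightarrow>\<^sub>0 'k::comm_ring_1)^3^3) set"
  where "mat_deg_part n = {A. \<forall>i j. A $ i $ j \<in> deg_part n}"

definition degree0 :: "(int \<Rightarrow> 'a set) \<Rightarrow> (int \<Rightarrow> 'b set) \<Rightarrow> ('a \<Rightarrow> 'b) \<Rightarrow> bool"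
  where "degree0 G H f \<longleftrightarrow> (\<forall>n. f ` G n \<subseteq> H n)"


section \<open>The algebra \<open>V\<close>, its localization, and the modules \<open>M\<close>\<close>

datatype gen = E0 | E1

text \<open>The index choices that make \<open>(gen word, 'k) lquot\<close> the module \<open>V / V e\<^sub>0\<close>.\<close>
class killed_letters =
  fixes killed :: "'a set"

instantiation word :: (killed_letters) with_ann
begin
definition ann_word :: "'a word set" where "ann_word = (\<lambda>g. Word [g]) ` killed"
instance ..
end

instantiation gen :: killed_letters
begin
definition killed_gen :: "gen set" where "killed_gen = {E0}"
instance ..
end

type_synonym 'k V = "gen word \<Rightarrow>\<^sub>0 'k"
type_synonym 'k V2 = "(gen word \<times> gen word) \<Rightarrow>\<^sub>0 'k"
type_synonym 'k M = "(gen word, 'k) lquot"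
type_synonym 'k M2 = "(gen word \<times> gen word, 'k) lquot"

definition e0 :: "'k::comm_ring_1 V" where "e0 = mon (Word [E0])"
definition e1 :: "'k::comm_ring_1 V" where "e1 = mon (Word [E1])"
definition einf :: "'k::comm_ring_1 V" where "einf = - e0 - e1"

definition one_DR :: "'k::comm_ring_1 M" where "one_DR = qclass 1"
definition one_DR2 :: "'k::comm_ring_1 M2" where "one_DR2 = qtens one_DR one_DR"

text \<open>
  \<open>V[1/e\<^sub>1]\<close> is the monoid algebra of the monoid with generators \<open>e\<^sub>0, e\<^sub>1, e\<^sub>1\<^sup>-\<^sup>1\<close> and relations
  \<open>e\<^sub>1 e\<^sub>1\<^sup>-\<^sup>1 = e\<^sub>1\<^sup>-\<^sup>1 e\<^sub>1 = 1\<close>.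
\<close>
datatype lgen = L0 | L1 | L1inv

inductive loc_cong :: "lgen list \<Rightarrow> lgen list \<Rightarrow> bool" where
  loc_cong_refl: "loc_cong u u"
| loc_cong_sym: "loc_cong u v \<Longrightarrow> loc_cong v u"
| loc_cong_trans: "loc_cong u v \<Longrightarrow> loc_cong v w \<Longrightarrow> loc_cong u w"
| loc_cong_append: "loc_cong u u' \<Longrightarrow> loc_cong v v' \<Longrightarrow> loc_cong (u @ v) (u' @ v')"
| loc_cong_right_inv: "loc_cong [L1, L1inv] []"
| loc_cong_left_inv: "loc_cong [L1inv, L1] []"

quotient_type lword = "lgen list" / loc_cong
  by (intro equivpI reflpI sympI transpI) (fact loc_cong_refl, erule loc_cong_sym, erule (1) loc_cong_trans)

instantiation lword :: graded_monoid
begin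
lift_definition zero_lword :: lword is "[]" .
lift_definition plus_lword :: "lword \<Rightarrow> lword \<Rightarrow> lword" is "(@)" by (rule loc_cong_append)
lift_definition mdeg_lword :: "lword \<Rightarrow> int"
  is "\<lambda>u. sum_list (map (\<lambda>g. case g of L0 \<Rightarrow> 1 | L1 \<Rightarrow> 1 | L1inv \<Rightarrow> - 1) u)"
proof -
  fix u v assume "loc_cong u v"
  then show "sum_list (map (\<lambda>g. case g of L0 \<Rightarrow> 1 | L1 \<Rightarrow> 1 | L1inv \<Rightarrow> - 1) u)
    = (sum_list (map (\<lambda>g. case g of L0 \<Rightarrow> 1 | L1 \<Rightarrow> 1 | L1inv \<Rightarrow> - 1) v) :: int)"
    by induction auto
qed
instance
  by standard (transfer; simp add: loc_cong_refl)+
end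

instantiation lword :: with_ann
begin
lift_definition lletter :: "lgen \<Rightarrow> lword" is "\<lambda>g. [g]" .
definition ann_lword :: "lword set" where "ann_lword = {lletter L0}"
instance ..
end

type_synonym 'k Vloc = "lword \<Rightarrow>\<^sub>0 'k"
type_synonym 'k Vloc2 = "(lword \<times> lword) \<Rightarrow>\<^sub>0 'k"
type_synonym 'k Mloc = "(lword, 'k) lquot"
type_synonym 'k Mloc2 = "(lword \<times> lword, 'k) lquot"

definition loc_word :: "gen word \<Rightarrow> lword"
  where "loc_word w = abs_lword (map (\<lambda>g. case g of E0 \<Rightarrow> L0 | E1 \<Rightarrow> L1) (letters w))"

definition loc_word2 :: "gen word \<times> gen word \<Rightarrow> lword \<times> lword"
  where "loc_word2 = map_prod loc_word loc_word"

lemma loc_word_simps: "loc_word 0 = 0" "loc_word (u + v) = loc_word u + loc_word v"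
  by (simp_all add: loc_word_def zero_word_def plus_word_def zero_lword_def plus_lword.abs_eq)

lemma loc_word2_simps: "loc_word2 0 = 0" "loc_word2 (u + v) = loc_word2 u + loc_word2 v"
  by (simp_all add: loc_word2_def zero_prod_def map_prod_def split_beta loc_word_simps)

lemma loc_word_ann: "loc_word ` ann \<subseteq> ann"
  by (auto simp: loc_word_def ann_word_def ann_lword_def killed_gen_def lletter.abs_eq)

lemma loc_word2_ann: "loc_word2 ` ann \<subseteq> ann"
  using loc_word_ann by (auto simp: loc_word2_def ann_prod_def loc_word_simps)

definition loc_V2 :: "'k::comm_ring_1 V2 \<Rightarrow> 'k Vloc2" where "loc_V2 = mon_map loc_word2"

lift_definition loc_M2 :: "'k::comm_ring_1 M2 \<Rightarrow> 'k Mloc2" is "mon_map loc_word2"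
proof -
  fix x y :: "'k V2" assume "x - y \<in> annI"
  then have "mon_map loc_word2 (x - y) \<in> annI"
    by (intro mon_map_left_ideal loc_word2_simps loc_word2_ann)
  then show "mon_map loc_word2 x - mon_map loc_word2 y \<in> annI"
    by (simp only: ring_hom_simps(6)[OF ring_hom_mon_map[OF loc_word2_simps]])
qed

definition Mloc_ge_part :: "int \<Rightarrow> 'k::comm_ring_1 Mloc set"
  where "Mloc_ge_part n = (if n \<ge> - 1 then qdeg_part n else {0})"

text \<open>
  \<open>(M[1/e\<^sub>1]\<^sub>\<ge>\<^sub>-\<^sub>1) \<otimes> (M[1/e\<^sub>1]\<^sub>\<ge>\<^sub>-\<^sub>1)\<close> and its homogeneous parts, as submodules of \<open>M[1/e\<^sub>1] \<otimes> M[1/e\<^sub>1]\<close>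
  (\<open>M[1/e\<^sub>1]\<^sub>\<ge>\<^sub>-\<^sub>1\<close> is a direct summand of \<open>M[1/e\<^sub>1]\<close>).
\<close>
definition Mloc2_ge_part :: "int \<Rightarrow> 'k::comm_ring_1 Mloc2 set"
  where "Mloc2_ge_part n =
    module.span qscale {qtens x y | x y i j. x \<in> Mloc_ge_part i \<and> y \<in> Mloc_ge_part j \<and> i + j = n}"

definition Mloc2_ge :: "'k::comm_ring_1 Mloc2 set"
  where "Mloc2_ge = module.span qscale {qtens x y | x y i j. x \<in> Mloc_ge_part i \<and> y \<in> Mloc_ge_part j}"


section \<open>The coproducts\<close>

text \<open>Used for \<open>n \<ge> 1\<close> only.\<close>
definition ygen :: "nat \<Rightarrow> 'k::comm_ring_1 V" where "ygen n = - (e0 ^ (n - 1) * e1)"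

definition W :: "'k::comm_ring_1 V set" where "W = {cst c + v * e1 | c v. True}"

text \<open>
  Since \<open>W\<close> is freely generated by the \<open>y\<^sub>n\<close>, \<open>n \<ge> 1\<close>, the map \<open>Y_eval\<close> is an isomorphism from the free
  algebra on letters \<open>Y\<^sub>0, Y\<^sub>1, \<dots>\<close> onto \<open>W\<close>; the letter \<open>Y\<^sub>n\<close> corresponds to \<open>y\<^sub>n\<^sub>+\<^sub>1\<close>.
  The values of \<open>\<Delta>W\<close> outside \<open>W\<close> are irrelevant.
\<close>
definition Y_eval :: "(nat word \<Rightarrow>\<^sub>0 'k) \<Rightarrow> 'k::comm_ring_1 V"
  where "Y_eval = mlift cst (word_prod (\<lambda>n. ygen (Suc n)))"

definition \<Delta>y :: "nat \<Rightarrow> 'k::comm_ring_1 V2"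
  where "\<Delta>y n = tens (ygen n) 1 + tens 1 (ygen n) + (\<Sum>k = 1..n - 1. tens (ygen k) (ygen (n - k)))"

definition \<Delta>W :: "'k::comm_ring_1 V \<Rightarrow> 'k V2"
  where "\<Delta>W w = mlift cst (word_prod (\<lambda>n. \<Delta>y (Suc n))) (the_inv Y_eval w)"

definition \<Delta>M :: "'k::comm_ring_1 M \<Rightarrow> 'k M2"
  where "\<Delta>M m = \<Delta>W (THE w. w \<in> W \<and> w \<rhd> one_DR = m) \<rhd> one_DR2"


section \<open>The Lie algebra \<open>p\<^sub>5\<close>\<close>

typedef p5gen = "{(i, j). i \<in> {1..5::nat} \<and> j \<in> {1..5} \<and> i \<noteq> j}"
  by (rule exI[of _ "(1, 2)"]) simp

text \<open>
  Lie algebra expressions in the generators, modulo the smallest congruence that contains the axioms of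
  Lie algebras over \<open>'k\<close> and the defining relations.
\<close>
datatype 'k lterm = LGen p5gen | LZero | LAdd "'k lterm" "'k lterm" | LScale 'k "'k lterm"
  | LBr "'k lterm" "'k lterm"

abbreviation lt_gen :: "nat \<Rightarrow> nat \<Rightarrow> 'k lterm" where "lt_gen i j \<equiv> LGen (Abs_p5gen (i, j))"

inductive lcong :: "'k::comm_ring_1 lterm \<Rightarrow> 'k lterm \<Rightarrow> bool" where
  lc_refl: "lcong x x"
| lc_sym: "lcong x y \<Longrightarrow> lcong y x"
| lc_trans: "lcong x y \<Longrightarrow> lcong y z \<Longrightarrow> lcong x z"
| lc_add: "lcong x x' \<Longrightarrow> lcong y y' \<Longrightarrow> lcong (LAdd x y) (LAdd x' y')"
| lc_scale: "lcong x x' \<Longrightarrow> lcong (LScale c x) (LScale c x')"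
| lc_br: "lcong x x' \<Longrightarrow> lcong y y' \<Longrightarrow> lcong (LBr x y) (LBr x' y')"
| add_assoc: "lcong (LAdd (LAdd x y) z) (LAdd x (LAdd y z))"
| add_comm: "lcong (LAdd x y) (LAdd y x)"
| add_zero: "lcong (LAdd LZero x) x"
| add_neg: "lcong (LAdd x (LScale (- 1) x)) LZero"
| scale_add_right: "lcong (LScale c (LAdd x y)) (LAdd (LScale c x) (LScale c y))"
| scale_add_left: "lcong (LScale (c + d) x) (LAdd (LScale c x) (LScale d x))"
| scale_scale: "lcong (LScale c (LScale d x)) (LScale (c * d) x)"
| scale_one: "lcong (LScale 1 x) x"
| br_add_left: "lcong (LBr (LAdd x y) z) (LAdd (LBr x z) (LBr y z))"
| br_add_right: "lcong (LBr x (LAdd y z)) (LAdd (LBr x y) (LBr x z))"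
| br_scale_left: "lcong (LBr (LScale c x) y) (LScale c (LBr x y))"
| br_scale_right: "lcong (LBr x (LScale c y)) (LScale c (LBr x y))"
| br_self: "lcong (LBr x x) LZero"
| jacobi: "lcong (LAdd (LBr x (LBr y z)) (LAdd (LBr y (LBr z x)) (LBr z (LBr x y)))) LZero"
| rel_sym: "\<lbrakk>i \<in> {1..5}; j \<in> {1..5}; i \<noteq> j\<rbrakk> \<Longrightarrow> lcong (lt_gen i j) (lt_gen j i)"
| rel_sum: "i \<in> {1..5} \<Longrightarrow> lcong (foldr LAdd (map (lt_gen i) (filter (\<lambda>j. j \<noteq> i) [1..<6])) LZero) LZero"
| rel_comm: "\<lbrakk>{i, j, k, l} \<subseteq> {1..5}; distinct [i, j, k, l]\<rbrakk> \<Longrightarrow> lcong (LBr (lt_gen i j) (lt_gen k l)) LZero"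

quotient_type (overloaded) 'k p5 = "'k::comm_ring_1 lterm" / lcong
  by (intro equivpI reflpI sympI transpI) (fact lc_refl, erule lc_sym, erule (1) lc_trans)

instantiation p5 :: (comm_ring_1) ab_group_add
begin
lift_definition zero_p5 :: "'a p5" is LZero .
lift_definition plus_p5 :: "'a p5 \<Rightarrow> 'a p5 \<Rightarrow> 'a p5" is LAdd by (rule lc_add)
lift_definition uminus_p5 :: "'a p5 \<Rightarrow> 'a p5" is "LScale (- 1)" by (rule lc_scale)
definition minus_p5 :: "'a p5 \<Rightarrow> 'a p5 \<Rightarrow> 'a p5" where "minus_p5 x y = x + - y"
instance
proof
  fix a b c :: "'a p5"
  show "a + b + c = a + (b + c)" by transfer (rule add_assoc)
  show ab: "a + b = b + a" for a b :: "'a p5" by transfer (rule add_comm)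
  show "0 + a = a" by transfer (rule add_zero)
  have "a + - a = 0" by transfer (rule add_neg)
  then show "- a + a = 0" by (simp only: ab)
  show "a - b = a + - b" by (rule minus_p5_def)
qed
end

lift_definition p5_scale :: "'k::comm_ring_1 \<Rightarrow> 'k p5 \<Rightarrow> 'k p5" is LScale by (rule lc_scale)
lift_definition p5_br :: "'k::comm_ring_1 p5 \<Rightarrow> 'k p5 \<Rightarrow> 'k p5" is LBr by (rule lc_br)

text \<open>Meaningful for distinct \<open>i, j \<in> {1..5}\<close> only.\<close>
lift_definition p5e :: "nat \<Rightarrow> nat \<Rightarrow> 'k::comm_ring_1 p5" is lt_gen .

text \<open>The Lie algebra morphism into an associative algebra with given values on the generators.\<close>
primrec lterm_eval :: "(nat \<times> nat \<Rightarrow> 'm \<Rightarrow>\<^sub>0 'k) \<Rightarrow> 'k lterm \<Rightarrow> 'm::monoid_add \<Rightarrow>\<^sub>0 'k::comm_ring_1" where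
  "lterm_eval f (LGen g) = f (Rep_p5gen g)"
| "lterm_eval f LZero = 0"
| "lterm_eval f (LAdd x y) = lterm_eval f x + lterm_eval f y"
| "lterm_eval f (LScale c x) = cst c * lterm_eval f x"
| "lterm_eval f (LBr x y) = lterm_eval f x * lterm_eval f y - lterm_eval f y * lterm_eval f x"

lemma cst_left_commute: "x * (cst c * y) = cst c * (x * y)"
  by (simp only: mult.assoc[symmetric] cst_central[of c x])

lemma lterm_eval_cong:
  assumes "lcong x y"
    and f_sym: "\<And>i j. \<lbrakk>i \<in> {1..5}; j \<in> {1..5}; i \<noteq> j\<rbrakk> \<Longrightarrow> f (i, j) = f (j, i)"
    and f_sum: "\<And>i. i \<in> {1..5} \<Longrightarrow> (\<Sum>j\<leftarrow>filter (\<lambda>j. j \<noteq> i) [1..<6]. f (i, j)) = 0"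
    and f_comm: "\<And>i j k l. \<lbrakk>{i, j, k, l} \<subseteq> {1..5}; distinct [i, j, k, l]\<rbrakk> \<Longrightarrow> f (i, j) * f (k, l) = f (k, l) * f (i, j)"
  shows "lterm_eval f x = lterm_eval f y"
  using assms(1)
proof induction
  case (rel_sym i j)
  then show ?case using f_sym[of i j] by (simp add: Abs_p5gen_inverse)
next
  case (rel_sum i)
  have "lterm_eval f (foldr LAdd (map (lt_gen i) js) LZero) = (\<Sum>j\<leftarrow>js. f (i, j))"
    if "set js \<subseteq> {1..5} - {i}" for js
    using that rel_sum by (induction js) (auto simp: Abs_p5gen_inverse)
  moreover have "set (filter (\<lambda>j. j \<noteq> i) [1..<6]) \<subseteq> {1..5} - {i}"
    by auto
  ultimately show ?case
    using f_sum[OF rel_sum] by (simp only: lterm_eval.simps)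
next
  case (rel_comm i j k l)
  then show ?case using f_comm[of i j k l] by (simp add: Abs_p5gen_inverse)
next
  case (scale_add_left c d x)
  show ?case by (simp add: single_add distrib_right)
next
  case (scale_scale c d x)
  show ?case by (simp add: mult.assoc[symmetric] mult_single)
next
  case (br_scale_left c x y)
  show ?case by (simp add: cst_left_commute mult.assoc right_diff_distrib)
next
  case (br_scale_right x c y)
  show ?case by (simp add: cst_left_commute mult.assoc right_diff_distrib)
next
  case (add_neg x)
  show ?case by (simp add: single_uminus)
qed (auto simp: algebra_simps)

definition pr1_gen :: "nat \<times> nat \<Rightarrow> 'k::comm_ring_1 V" where
  "pr1_gen = (\<lambda>(i, j).
    if {i, j} \<in> {{2,3}, {4,5}} then e0
    else if {i, j} \<in> {{2,5}, {3,4}} then e1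
    else if {i, j} \<in> {{2,4}, {3,5}} then einf
    else 0)"

definition pr2_gen :: "nat \<times> nat \<Rightarrow> 'k::comm_ring_1 V" where
  "pr2_gen = (\<lambda>(i, j).
    if {i, j} \<in> {{1,4}, {3,5}} then e0
    else if {i, j} \<in> {{1,5}, {3,4}} then e1
    else if {i, j} \<in> {{1,3}, {4,5}} then einf
    else 0)"

lemma ball_1_5: "i \<in> {1..5::nat} \<longleftrightarrow> i = 1 \<or> i = 2 \<or> i = 3 \<or> i = 4 \<or> i = 5"
  by auto

lemma pr1_gen_comm:
  assumes "{i, j, k, l} \<subseteq> {1..5}" "distinct [i, j, k, l]"
  shows "(pr1_gen (i, j) :: 'k::comm_ring_1 V) * pr1_gen (k, l) = pr1_gen (k, l) * pr1_gen (i, j)"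
proof -
  have "i \<in> {1..5}" "j \<in> {1..5}" "k \<in> {1..5}" "l \<in> {1..5}" using assms by auto
  then show ?thesis using assms(2)
    unfolding ball_1_5 by (elim disjE) (simp_all add: pr1_gen_def doubleton_eq_iff)
qed

lemma pr2_gen_comm:
  assumes "{i, j, k, l} \<subseteq> {1..5}" "distinct [i, j, k, l]"
  shows "(pr2_gen (i, j) :: 'k::comm_ring_1 V) * pr2_gen (k, l) = pr2_gen (k, l) * pr2_gen (i, j)"
proof -
  have "i \<in> {1..5}" "j \<in> {1..5}" "k \<in> {1..5}" "l \<in> {1..5}" using assms by auto
  then show ?thesis using assms(2)
    unfolding ball_1_5 by (elim disjE) (simp_all add: pr2_gen_def doubleton_eq_iff)
qed

lift_definition pr1_lie :: "'k::comm_ring_1 p5 \<Rightarrow> 'k V" is "lterm_eval pr1_gen"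
proof (erule lterm_eval_cong)
  fix i j :: nat
  show "(pr1_gen (i, j) :: 'k V) = pr1_gen (j, i)" by (simp add: pr1_gen_def insert_commute)
  assume "i \<in> {1..5}"
  then show "(\<Sum>j\<leftarrow>filter (\<lambda>j. j \<noteq> i) [1..<6]. pr1_gen (i, j) :: 'k V) = 0"
    unfolding ball_1_5
    by (elim disjE) (simp_all add: upt_rec pr1_gen_def doubleton_eq_iff einf_def)
qed (rule pr1_gen_comm)

lift_definition pr2_lie :: "'k::comm_ring_1 p5 \<Rightarrow> 'k V" is "lterm_eval pr2_gen"
proof (erule lterm_eval_cong)
  fix i j :: nat
  show "(pr2_gen (i, j) :: 'k V) = pr2_gen (j, i)" by (simp add: pr2_gen_def insert_commute)
  assume "i \<in> {1..5}"
  then show "(\<Sum>j\<leftarrow>filter (\<lambda>j. j \<noteq> i) [1..<6]. pr2_gen (i, j) :: 'k V) = 0"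
    unfolding ball_1_5
    by (elim disjE) (simp_all add: upt_rec pr2_gen_def doubleton_eq_iff einf_def)
qed (rule pr2_gen_comm)


section \<open>The universal enveloping algebra of \<open>p\<^sub>5\<close>\<close>

inductive_set ideal :: "'a::ring_1 set \<Rightarrow> 'a set" for S where
  ideal_gen: "x \<in> S \<Longrightarrow> x \<in> ideal S"
| ideal_zero: "0 \<in> ideal S"
| ideal_add: "x \<in> ideal S \<Longrightarrow> y \<in> ideal S \<Longrightarrow> x + y \<in> ideal S"
| ideal_left: "x \<in> ideal S \<Longrightarrow> a * x \<in> ideal S"
| ideal_right: "x \<in> ideal S \<Longrightarrow> x * a \<in> ideal S"

lemma ideal_minus: "x \<in> ideal S \<Longrightarrow> - x \<in> ideal S"
  using ideal_left[of x S "- 1"] by simp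

lemma ideal_diff: "x \<in> ideal S \<Longrightarrow> y \<in> ideal S \<Longrightarrow> x - y \<in> ideal S"
  using ideal_add[OF _ ideal_minus] by fastforce

lemma ring_hom_ideal:
  assumes "ring_hom f" "\<And>x. x \<in> S \<Longrightarrow> f x = 0" "x \<in> ideal S"
  shows "f x = 0"
  using assms(3) by induction (auto simp: assms(2) ring_hom_simps[OF assms(1)])

text \<open>The free algebra on the set \<open>p\<^sub>5\<close> modulo the relations that make the inclusion of \<open>p\<^sub>5\<close> linear and
  compatible with brackets.\<close>
abbreviation lmon :: "'k::comm_ring_1 p5 \<Rightarrow> 'k p5 word \<Rightarrow>\<^sub>0 'k" where "lmon x \<equiv> mon (Word [x])"

definition U_rels :: "('k::comm_ring_1 p5 word \<Rightarrow>\<^sub>0 'k) set" where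
  "U_rels =
    {lmon (x + y) - lmon x - lmon y | x y. True} \<union>
    {lmon (p5_scale c x) - cst c * lmon x | c x. True} \<union>
    {lmon x * lmon y - lmon y * lmon x - lmon (p5_br x y) | x y. True}"

quotient_type (overloaded) 'k Up5 = "'k::comm_ring_1 p5 word \<Rightarrow>\<^sub>0 'k" / "\<lambda>x y. x - y \<in> ideal U_rels"
proof (intro equivpI reflpI sympI transpI)
  fix x y z :: "'k p5 word \<Rightarrow>\<^sub>0 'k"
  show "x - x \<in> ideal U_rels" by (simp add: ideal_zero)
  show "y - x \<in> ideal U_rels" if "x - y \<in> ideal U_rels" using ideal_minus[OF that] by simp
  show "x - z \<in> ideal U_rels" if "x - y \<in> ideal U_rels" "y - z \<in> ideal U_rels"
    using ideal_add[OF that] by simp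
qed

lemma one_notin_U_ideal: "(1 :: 'k::comm_ring_1 p5 word \<Rightarrow>\<^sub>0 'k) \<notin> ideal U_rels"
proof
  define f :: "('k p5 word \<Rightarrow>\<^sub>0 'k) \<Rightarrow> 'k" where "f = mlift (\<lambda>c. c) (word_prod (\<lambda>_. 0))"
  have id: "ring_hom (\<lambda>c::'k. c)" by (simp add: ring_hom_def)
  have f: "ring_hom f"
    unfolding f_def by (intro ring_hom_mlift id word_prod_simps) (simp_all add: mult.commute)
  have [simp]: "f (lmon x) = 0" for x
    by (simp add: f_def mlift_single[OF id] word_prod_def)
  assume "(1 :: 'k p5 word \<Rightarrow>\<^sub>0 'k) \<in> ideal U_rels"
  then have "f 1 = 0"
    by (rule ring_hom_ideal[OF f, rotated]) (auto simp: U_rels_def ring_hom_simps[OF f])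
  then show False by (simp add: ring_hom_simps[OF f])
qed

instantiation Up5 :: (comm_ring_1) ring_1
begin
lift_definition zero_Up5 :: "'a Up5" is 0 .
lift_definition one_Up5 :: "'a Up5" is 1 .
lift_definition plus_Up5 :: "'a Up5 \<Rightarrow> 'a Up5 \<Rightarrow> 'a Up5" is "(+)"
  by (simp only: add_diff_add ideal_add)
lift_definition uminus_Up5 :: "'a Up5 \<Rightarrow> 'a Up5" is uminus
proof -
  fix x y :: "'a p5 word \<Rightarrow>\<^sub>0 'a" assume "x - y \<in> ideal U_rels"
  then show "- x - - y \<in> ideal U_rels" using ideal_minus[of "x - y"] by simp
qed
lift_definition minus_Up5 :: "'a Up5 \<Rightarrow> 'a Up5 \<Rightarrow> 'a Up5" is "(-)"
proof -
  fix x y x' y' :: "'a p5 word \<Rightarrow>\<^sub>0 'a" assume "x - y \<in> ideal U_rels" "x' - y' \<in> ideal U_rels"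
  then have "(x - y) - (x' - y') \<in> ideal U_rels" by (rule ideal_diff)
  then show "x - x' - (y - y') \<in> ideal U_rels" by (simp add: algebra_simps)
qed
lift_definition times_Up5 :: "'a Up5 \<Rightarrow> 'a Up5 \<Rightarrow> 'a Up5" is "(*)"
proof -
  fix x y x' y' :: "'a p5 word \<Rightarrow>\<^sub>0 'a" assume "x - y \<in> ideal U_rels" "x' - y' \<in> ideal U_rels"
  then have "(x - y) * x' + y * (x' - y') \<in> ideal U_rels" by (intro ideal_add ideal_left ideal_right)
  then show "x * x' - y * y' \<in> ideal U_rels" by (simp add: algebra_simps)
qed
instance
proof
  show "(0 :: 'a Up5) \<noteq> 1"
  proof (transfer, rule)
    assume "(0 :: 'a p5 word \<Rightarrow>\<^sub>0 'a) - 1 \<in> ideal U_rels"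
    from ideal_minus[OF this] show False using one_notin_U_ideal[where 'k = 'a] by simp
  qed
qed (transfer; simp add: ideal_zero algebra_simps)+
end

text \<open>The structure morphism of the algebra and the canonical map from the Lie algebra.\<close>
lift_definition U_cst :: "'k::comm_ring_1 \<Rightarrow> 'k Up5" is cst .
lift_definition U_incl :: "'k::comm_ring_1 p5 \<Rightarrow> 'k Up5" is lmon .

definition Ue :: "nat \<Rightarrow> nat \<Rightarrow> 'k::comm_ring_1 Up5" where "Ue i j = U_incl (p5e i j)"

definition lie_hom :: "('k::comm_ring_1 p5 \<Rightarrow> 'm::monoid_add \<Rightarrow>\<^sub>0 'k) \<Rightarrow> bool" where
  "lie_hom \<phi> \<longleftrightarrow> (\<forall>x y. \<phi> (x + y) = \<phi> x + \<phi> y) \<and> (\<forall>c x. \<phi> (p5_scale c x) = cst c * \<phi> x) \<and>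
     (\<forall>x y. \<phi> (p5_br x y) = \<phi> x * \<phi> y - \<phi> y * \<phi> x)"

abbreviation U_eval :: "('k::comm_ring_1 p5 \<Rightarrow> 'm::monoid_add \<Rightarrow>\<^sub>0 'k) \<Rightarrow> ('k p5 word \<Rightarrow>\<^sub>0 'k) \<Rightarrow> 'm \<Rightarrow>\<^sub>0 'k"
  where "U_eval \<phi> \<equiv> mlift cst (word_prod \<phi>)"

lemma U_eval_cong:
  assumes "lie_hom \<phi>" "x - y \<in> ideal U_rels"
  shows "U_eval \<phi> x = U_eval \<phi> y"
proof -
  have f: "ring_hom (U_eval \<phi>)" by (intro ring_hom_mlift_cst word_prod_simps)
  have [simp]: "U_eval \<phi> (lmon x) = \<phi> x" "U_eval \<phi> (cst c) = cst c" for x c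
    by (simp_all add: mlift_single[OF ring_hom_cst] word_prod_def zero_word_def)
  have "U_eval \<phi> (x - y) = 0"
    by (rule ring_hom_ideal[OF f _ assms(2)])
      (use assms(1) in \<open>auto simp: U_rels_def lie_hom_def ring_hom_simps[OF f]\<close>)
  then show ?thesis by (simp add: ring_hom_simps[OF f])
qed

lemma lie_hom_pr1: "lie_hom pr1_lie"
  unfolding lie_hom_def by (intro conjI allI; transfer) simp_all

lemma lie_hom_pr2: "lie_hom pr2_lie"
  unfolding lie_hom_def by (intro conjI allI; transfer) simp_all

lift_definition pr1 :: "'k::comm_ring_1 Up5 \<Rightarrow> 'k V" is "U_eval pr1_lie"
  by (rule U_eval_cong[OF lie_hom_pr1])

lift_definition pr2 :: "'k::comm_ring_1 Up5 \<Rightarrow> 'k V" is "U_eval pr2_lie"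
  by (rule U_eval_cong[OF lie_hom_pr2])

definition pr12_lie :: "'k::comm_ring_1 p5 \<Rightarrow> 'k V2"
  where "pr12_lie x = tens (pr1 (U_incl x)) 1 + tens 1 (pr2 (U_incl x))"

lemma lie_hom_pr12: "lie_hom (pr12_lie :: 'k::comm_ring_1 p5 \<Rightarrow> 'k V2)"
proof -
  have [simp]: "pr1 (U_incl x) = pr1_lie x" "pr2 (U_incl x) = pr2_lie x" for x :: "'k p5"
    by (transfer, simp add: mlift_single[OF ring_hom_cst] word_prod_def)+
  have 1: "tens x 1 = inl x" "tens 1 y = inr y" for x y :: "'k V"
    by (simp_all add: tens_def ring_hom_simps[OF ring_hom_inl] ring_hom_simps[OF ring_hom_inr])
  have 2: "inl (cst c) = cst c" "inr (cst c) = cst c" for c :: 'k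
    by (auto simp: inl_def inr_def zero_prod_def)
  have "lie_hom (pr1_lie :: 'k p5 \<Rightarrow> 'k V)" "lie_hom (pr2_lie :: 'k p5 \<Rightarrow> 'k V)"
    by (rule lie_hom_pr1 lie_hom_pr2)+
  then show ?thesis
    unfolding lie_hom_def pr12_lie_def
    by (simp add: 1 2 ring_hom_simps[OF ring_hom_inl] ring_hom_simps[OF ring_hom_inr]
        distrib_left distrib_right inl_inr_commute)
qed

lift_definition pr12 :: "'k::comm_ring_1 Up5 \<Rightarrow> 'k V2" is "U_eval pr12_lie"
  by (rule U_eval_cong[OF lie_hom_pr12])

definition ell :: "'k::comm_ring_1 V \<Rightarrow> 'k Up5"
  where "ell = mlift U_cst (word_prod (\<lambda>g. case g of E0 \<Rightarrow> Ue 2 3 | E1 \<Rightarrow> Ue 1 2))"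


section \<open>The morphism \<open>\<rho>\<close>\<close>

definition e5 :: "'k::comm_ring_1 Up5^3" where "e5 = vector [Ue 1 5, Ue 2 5, Ue 3 5]"

text \<open>
  \<open>e\<^sub>1\<^sub>5, e\<^sub>2\<^sub>5, e\<^sub>3\<^sub>5\<close> is a basis, as a left module, of a two-sided ideal of \<open>U p\<^sub>5\<close> (the kernel of \<open>pr\<^sub>5\<close>), so
  the matrix exists and is unique.
\<close>
definition varpi :: "'k::comm_ring_1 Up5 \<Rightarrow> 'k Up5^3^3"
  where "varpi p = (THE A. \<forall>i. e5 $ i * p = (\<Sum>j\<in>UNIV. A $ i $ j * e5 $ j))"

definition rho :: "'k::comm_ring_1 V \<Rightarrow> 'k V2^3^3"
  where "rho a = (\<chi> i j. pr12 (varpi (ell a) $ i $ j))"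

definition row1 :: "'k::comm_ring_1 V2^3"
  where "row1 = vector [tens e1 1, - tens 1 e1, 0]"

definition col0 :: "'k::comm_ring_1 M2^3"
  where "col0 = vector [0, - (tens e1 1 \<rhd> one_DR2), tens e1 1 \<rhd> one_DR2]"

definition e1f1_inv :: "'k::comm_ring_1 Vloc2"
  where "e1f1_inv = tens (mon (lletter L1inv)) (mon (lletter L1inv))"

definition rowcol :: "'k::comm_ring_1 V2^3^3 \<Rightarrow> 'k Mloc2"
  where "rowcol m = e1f1_inv \<rhd> (\<Sum>i\<in>UNIV. \<Sum>j\<in>UNIV. loc_V2 (row1 $ i * m $ i $ j) \<rhd> loc_M2 (col0 $ j))"

end

theory Submission
  imports Defs
begin

text \<open>
  Write \<open>E = e\<^sub>1 \<otimes> e\<^sub>1 = e\<^sub>1f\<^sub>1\<close>.  Commuting \<open>e\<^sub>i\<^sub>5\<close> past \<open>e\<^sub>1\<^sub>2\<close> and \<open>e\<^sub>2\<^sub>3\<close> gives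
  \<open>\<rho>(e\<^sub>1) = (1, -1, 0)\<^sup>T row\<^sub>1\<close> and a matrix \<open>\<rho>(e\<^sub>0)\<close> with \<open>\<rho>(e\<^sub>0) col\<^sub>0 = 0\<close>, so both sides vanish on
  \<open>V e\<^sub>0\<close> and it remains to treat \<open>W\<close>.  There \<open>row\<^sub>1 \<rho>(y\<^sub>n) = c\<^sub>n row\<^sub>1\<close> for a scalar \<open>c\<^sub>n\<close>, computed from the
  recursion for \<open>row\<^sub>1 \<rho>(e\<^sub>0\<^sup>m)\<close>, which satisfies \<open>c\<^sub>n E = E \<Delta>(y\<^sub>n)\<close>.  Multiplicativity gives
  \<open>row\<^sub>1 \<rho>(w) = c row\<^sub>1\<close> with \<open>c E = E \<Delta>(w)\<close> for all \<open>w\<close> in \<open>W\<close>, and the claim follows from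
  \<open>row\<^sub>1 col\<^sub>0 = E \<cdot> 1\<close>.
\<close>

lemma ring_hom_sum: "ring_hom f \<Longrightarrow> f (sum g S) = (\<Sum>x\<in>S. f (g x))"
  by (induction S rule: infinite_finite_induct) (simp_all add: ring_hom_simps)

section \<open>The universal property of \<open>U p\<^sub>5\<close>\<close>

text \<open>Unlike for \<open>lterm_eval\<close>, the target is an arbitrary ring with structure
  morphism \<open>\<eta>\<close>; below it will be a ring of matrices over U p_5.\<close>

primrec lt_lift :: "('k \<Rightarrow> 'r) \<Rightarrow> (nat \<times> nat \<Rightarrow> 'r) \<Rightarrow> 'k lterm \<Rightarrow> 'r::ring_1" where
  "lt_lift \<eta> f (LGen g) = f (Rep_p5gen g)"
| "lt_lift \<eta> f LZero = 0"
| "lt_lift \<eta> f (LAdd x y) = lt_lift \<eta> f x + lt_lift \<eta> f y"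
| "lt_lift \<eta> f (LScale c x) = \<eta> c * lt_lift \<eta> f x"
| "lt_lift \<eta> f (LBr x y) = lt_lift \<eta> f x * lt_lift \<eta> f y - lt_lift \<eta> f y * lt_lift \<eta> f x"

text \<open>Centrality of \<open>\<eta>\<close> makes the commutator bilinear, the assumptions on
  \<open>f\<close> are the relations of p_5, and the remaining cases are ring identities.\<close>

lemma lt_lift_cong:
  fixes \<eta> :: "'k::comm_ring_1 \<Rightarrow> 'r::ring_1"
  assumes "lcong x y" and \<eta>: "ring_hom \<eta>" and central: "\<And>c a. \<eta> c * a = a * \<eta> c"
    and f_sym: "\<And>i j. \<lbrakk>i \<in> {1..5}; j \<in> {1..5}; i \<noteq> j\<rbrakk> \<Longrightarrow> f (i, j) = f (j, i)"
    and f_sum: "\<And>i. i \<in> {1..5} \<Longrightarrow> (\<Sum>j\<leftarrow>filter (\<lambda>j. j \<noteq> i) [1..<6]. f (i, j)) = 0"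
    and f_comm: "\<And>i j k l. \<lbrakk>{i, j, k, l} \<subseteq> {1..5}; distinct [i, j, k, l]\<rbrakk> \<Longrightarrow> f (i, j) * f (k, l) = f (k, l) * f (i, j)"
  shows "lt_lift \<eta> f x = lt_lift \<eta> f y"
  using assms(1)
proof induction
  case (rel_sym i j)
  then show ?case using f_sym[of i j] by (simp add: Abs_p5gen_inverse)
next
  case (rel_sum i)
  have "lt_lift \<eta> f (foldr LAdd (map (lt_gen i) js) LZero) = (\<Sum>j\<leftarrow>js. f (i, j))"
    if "set js \<subseteq> {1..5} - {i}" for js
    using that rel_sum by (induction js) (auto simp: Abs_p5gen_inverse)
  moreover have "set (filter (\<lambda>j. j \<noteq> i) [1..<6]) \<subseteq> {1..5} - {i}"
    by auto
  ultimately show ?case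
    using f_sum[OF rel_sum] by (simp only: lt_lift.simps)
next
  case (rel_comm i j k l)
  then show ?case using f_comm[of i j k l] by (simp add: Abs_p5gen_inverse)
next
  case (br_scale_left c x y)
  have "lt_lift \<eta> f y * (\<eta> c * lt_lift \<eta> f x) = \<eta> c * (lt_lift \<eta> f y * lt_lift \<eta> f x)"
    by (metis mult.assoc central)
  then show ?case by (simp add: mult.assoc right_diff_distrib)
next
  case (br_scale_right x c y)
  have "lt_lift \<eta> f x * (\<eta> c * lt_lift \<eta> f y) = \<eta> c * (lt_lift \<eta> f x * lt_lift \<eta> f y)"
    by (metis mult.assoc central)
  then show ?case by (simp add: mult.assoc right_diff_distrib)
qed (auto simp: algebra_simps ring_hom_simps[OF \<eta>])

text \<open>The map descends through two quotients: from Lie terms to p_5 by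
  \<open>lt_lift_cong\<close>, then from the free algebra on p_5 to U p_5, because the extension of
  \<open>L\<close> kills \<open>U_rels\<close>.\<close>

proposition Up5_universal:
  fixes \<eta> :: "'k::comm_ring_1 \<Rightarrow> 'r::ring_1"
  assumes \<eta>: "ring_hom \<eta>" and central: "\<And>c a. \<eta> c * a = a * \<eta> c"
    and f_sym: "\<And>i j. \<lbrakk>i \<in> {1..5}; j \<in> {1..5}; i \<noteq> j\<rbrakk> \<Longrightarrow> f (i, j) = f (j, i)"
    and f_sum: "\<And>i. i \<in> {1..5} \<Longrightarrow> (\<Sum>j\<leftarrow>filter (\<lambda>j. j \<noteq> i) [1..<6]. f (i, j)) = 0"
    and f_comm: "\<And>i j k l. \<lbrakk>{i, j, k, l} \<subseteq> {1..5}; distinct [i, j, k, l]\<rbrakk> \<Longrightarrow> f (i, j) * f (k, l) = f (k, l) * f (i, j)"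
  obtains \<Phi> :: "'k Up5 \<Rightarrow> 'r" where "ring_hom \<Phi>" "\<And>c. \<Phi> (U_cst c) = \<eta> c"
    "\<And>i j. \<lbrakk>i \<in> {1..5}; j \<in> {1..5}; i \<noteq> j\<rbrakk> \<Longrightarrow> \<Phi> (Ue i j) = f (i, j)"
proof -
  \<comment> \<open>The choice of representative is immaterial by \<open>L_abs\<close>.\<close>
  define L :: "'k p5 \<Rightarrow> 'r" where "L x = lt_lift \<eta> f (rep_p5 x)" for x
  have L_abs: "L (abs_p5 t) = lt_lift \<eta> f t" for t
  proof -
    have "lcong t t" by (rule lc_refl)
    then have "lcong (rep_p5 (abs_p5 t)) t" by (rule rep_abs_rsp_left[OF Quotient3_p5])
    from lt_lift_cong[OF this \<eta> central f_sym f_sum f_comm] show ?thesis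
      by (simp add: L_def)
  qed
  have surj: "\<exists>t. x = abs_p5 t" for x :: "'k p5"
    by (metis Quotient3_abs_rep[OF Quotient3_p5])
  have L_add: "L (x + y) = L x + L y" for x y
    using surj[of x] surj[of y] by (auto simp: plus_p5.abs_eq L_abs)
  have L_scale: "L (p5_scale c x) = \<eta> c * L x" for c x
    using surj[of x] by (auto simp: p5_scale.abs_eq L_abs)
  have L_br: "L (p5_br x y) = L x * L y - L y * L x" for x y
    using surj[of x] surj[of y] by (auto simp: p5_br.abs_eq L_abs)
  let ?E = "mlift \<eta> (word_prod L)"
  have E: "ring_hom ?E" by (intro ring_hom_mlift \<eta> central word_prod_simps)
  have [simp]: "?E (lmon x) = L x" "?E (cst c) = \<eta> c" for x c
    by (simp_all add: mlift_single[OF \<eta>] word_prod_def zero_word_def ring_hom_simps[OF \<eta>])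
  have E_cong: "?E x = ?E y" if "x - y \<in> ideal U_rels" for x y
  proof -
    have "?E (x - y) = 0"
      by (rule ring_hom_ideal[OF E _ that])
        (auto simp: U_rels_def ring_hom_simps[OF E] L_add L_scale L_br)
    then show ?thesis by (simp add: ring_hom_simps[OF E])
  qed
  define \<Phi> :: "'k Up5 \<Rightarrow> 'r" where "\<Phi> u = ?E (rep_Up5 u)" for u
  have \<Phi>_abs: "\<Phi> (abs_Up5 t) = ?E t" for t
  proof -
    have "t - t \<in> ideal U_rels" by (simp add: ideal_zero)
    then have "rep_Up5 (abs_Up5 t) - t \<in> ideal U_rels"
      by (rule rep_abs_rsp_left[OF Quotient3_Up5])
    from E_cong[OF this] show ?thesis by (simp add: \<Phi>_def)
  qed
  have surjU: "\<exists>t. x = abs_Up5 t" for x :: "'k Up5"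
    by (metis Quotient3_abs_rep[OF Quotient3_Up5])
  have "\<Phi> (x + y) = \<Phi> x + \<Phi> y" "\<Phi> (x * y) = \<Phi> x * \<Phi> y" for x y
    using surjU[of x] surjU[of y]
    by (auto simp: plus_Up5.abs_eq times_Up5.abs_eq \<Phi>_abs ring_hom_simps[OF E])
  moreover have "\<Phi> 1 = 1" by (simp add: one_Up5.abs_eq \<Phi>_abs ring_hom_simps[OF E])
  ultimately have "ring_hom \<Phi>" by (simp add: ring_hom_def)
  moreover have "\<Phi> (U_cst c) = \<eta> c" for c by (simp add: U_cst.abs_eq \<Phi>_abs)
  moreover have "\<Phi> (Ue i j) = f (i, j)" if "i \<in> {1..5}" "j \<in> {1..5}" "i \<noteq> j" for i j
    using that by (simp add: Ue_def U_incl.abs_eq \<Phi>_abs p5e.abs_eq L_abs Abs_p5gen_inverse)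
  ultimately show thesis by (rule that)
qed

text \<open>Suitable values on the other five generators satisfy the linear relations, and all
  commutation relations then reduce to the six in \<open>rels\<close>.\<close>

lemma Up5_lift_exists:
  fixes \<eta> :: "'k::comm_ring_1 \<Rightarrow> 'r::ring_1" and P Q X1 X2 X3 :: 'r
  assumes \<eta>: "ring_hom \<eta>" and central: "\<And>c a. \<eta> c * a = a * \<eta> c"
    and rels: "X1 * P = P * X1 + X2 * X1 - X1 * X2" "X2 * P = P * X2 + X1 * X2 - X2 * X1" "X3 * P = P * X3"
      "X1 * Q = Q * X1" "X2 * Q = Q * X2 + X3 * X2 - X2 * X3" "X3 * Q = Q * X3 + X2 * X3 - X3 * X2"
  obtains \<Phi> :: "'k Up5 \<Rightarrow> 'r" where "ring_hom \<Phi>" "\<Phi> (Ue 1 2) = P" "\<Phi> (Ue 2 3) = Q"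
    "\<Phi> (Ue 1 5) = X1" "\<Phi> (Ue 2 5) = X2" "\<Phi> (Ue 3 5) = X3"
    "\<And>c. \<Phi> (U_cst c) = \<eta> c"
proof -
  \<comment> \<open>The values from e_45 on come from solving the linear relations; the final 0 is a
    default for pairs that index no generator.\<close>
  define f :: "nat \<times> nat \<Rightarrow> 'r" where "f = (\<lambda>(i, j).
    if {i, j} = {1,2} then P else if {i, j} = {2,3} then Q
    else if {i, j} = {1,5} then X1 else if {i, j} = {2,5} then X2 else if {i, j} = {3,5} then X3
    else if {i, j} = {4,5} then - X1 - X2 - X3
    else if {i, j} = {3,4} then P + X1 + X2 else if {i, j} = {1,4} then Q + X2 + X3
    else if {i, j} = {1,3} then - P - Q - X1 - X2 - X3
    else if {i, j} = {2,4} then - P - Q - X2 else 0)"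
  have f_sym: "f (i, j) = f (j, i)" for i j by (simp add: f_def insert_commute)
  have f_sum: "(\<Sum>j\<leftarrow>filter (\<lambda>j. j \<noteq> i) [1..<6]. f (i, j)) = 0" if "i \<in> {1..5}" for i
    using that unfolding ball_1_5
    by (elim disjE) (simp_all add: upt_rec f_def doubleton_eq_iff)
  have f_comm: "f (i, j) * f (k, l) = f (k, l) * f (i, j)"
    if "{i, j, k, l} \<subseteq> {1..5}" "distinct [i, j, k, l]" for i j k l
  proof -
    have "i \<in> {1..5}" "j \<in> {1..5}" "k \<in> {1..5}" "l \<in> {1..5}" using that by auto
    then show ?thesis using that(2)
      unfolding ball_1_5 by (elim disjE) (simp_all add: f_def doubleton_eq_iff rels algebra_simps)
  qed
  from Up5_universal[OF \<eta> central, of f] f_sym f_sum f_comm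
  obtain \<Phi> :: "'k Up5 \<Rightarrow> 'r" where \<Phi>: "ring_hom \<Phi>" "\<And>c. \<Phi> (U_cst c) = \<eta> c"
    and \<Phi>_gen: "\<And>i j. \<lbrakk>i \<in> {1..5}; j \<in> {1..5}; i \<noteq> j\<rbrakk> \<Longrightarrow> \<Phi> (Ue i j) = f (i, j)"
    by blast
  show thesis
    by (rule that[OF \<Phi>(1) _ _ _ _ _ \<Phi>(2)]; subst \<Phi>_gen; simp add: f_def doubleton_eq_iff)
qed


declare One_nat_def [simp del] \<comment> \<open>keeps the indices in \<open>Ue 1 2\<close> etc. in numeral form\<close>

section \<open>Relations in \<open>U p\<^sub>5\<close>\<close>

lemma U_incl_add: "U_incl (x + y) = U_incl x + U_incl y"
proof transfer
  fix x y :: "'a p5"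
  have "lmon (x + y) - lmon x - lmon y \<in> ideal U_rels"
    by (rule ideal_gen) (auto simp: U_rels_def)
  then show "lmon (x + y) - (lmon x + lmon y) \<in> ideal U_rels" by (simp add: diff_diff_eq)
qed

lemma U_incl_zero: "U_incl 0 = 0"
  using U_incl_add[of 0 0] by simp

lemma U_incl_scale: "U_incl (p5_scale c x) = U_cst c * U_incl x"
proof transfer
  fix c and x :: "'a p5"
  show "lmon (p5_scale c x) - cst c * lmon x \<in> ideal U_rels"
    by (rule ideal_gen) (auto simp: U_rels_def)
qed

lemma U_incl_br: "U_incl (p5_br x y) = U_incl x * U_incl y - U_incl y * U_incl x"
proof transfer
  fix x y :: "'a p5"
  have "lmon x * lmon y - lmon y * lmon x - lmon (p5_br x y) \<in> ideal U_rels"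
    by (rule ideal_gen) (auto simp: U_rels_def)
  from ideal_minus[OF this]
  show "lmon (p5_br x y) - (lmon x * lmon y - lmon y * lmon x) \<in> ideal U_rels" by simp
qed

lemma ring_hom_U_cst: "ring_hom U_cst"
  unfolding ring_hom_def
  by (intro conjI allI; transfer; simp add: single_add mult_single ideal_zero)

lemma U_cst_central: "U_cst c * x = x * U_cst c"
  by transfer (simp add: cst_central[of _ "rep_Up5 _"] cst_central ideal_zero)

lemma Ue_sym: "\<lbrakk>i \<in> {1..5}; j \<in> {1..5}; i \<noteq> j\<rbrakk> \<Longrightarrow> Ue i j = Ue j i"
  unfolding Ue_def by (rule arg_cong[of _ _ U_incl], transfer) (rule rel_sym)

lemma Ue_sum:
  assumes "i \<in> {1..5}"
  shows "(\<Sum>j\<leftarrow>filter (\<lambda>j. j \<noteq> i) [1..<6]. Ue i j) = (0 :: 'k::comm_ring_1 Up5)"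
proof -
  have *: "(\<Sum>j\<leftarrow>js. Ue i j) = (U_incl (abs_p5 (foldr LAdd (map (lt_gen i) js) LZero)) :: 'k Up5)" for js
    by (induction js)
      (simp_all add: U_incl_zero U_incl_add Ue_def p5e.abs_eq zero_p5_def[symmetric] plus_p5.abs_eq[symmetric])
  have "abs_p5 (foldr LAdd (map (lt_gen i) (filter (\<lambda>j. j \<noteq> i) [1..<6])) LZero) = (0 :: 'k p5)"
    unfolding zero_p5_def using rel_sum[OF assms] by (simp only: p5.abs_eq_iff)
  then show ?thesis by (simp only: * U_incl_zero)
qed

lemma Ue_comm:
  assumes "{i, j, k, l} \<subseteq> {1..5}" "distinct [i, j, k, l]"
  shows "Ue i j * Ue k l = Ue k l * (Ue i j :: 'k::comm_ring_1 Up5)"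
proof -
  have "p5_br (p5e i j) (p5e k l) = (0 :: 'k p5)"
    unfolding p5e.abs_eq p5_br.abs_eq zero_p5_def p5.abs_eq_iff by (rule rel_comm[OF assms])
  then show ?thesis using U_incl_br[of "p5e i j :: 'k p5" "p5e k l"] by (simp add: U_incl_zero Ue_def)
qed

text \<open>The e_ij generate U p_5 as an algebra. Closure is carried along the construction: Lie
  terms, words in elements of p_5, linear combinations of words.\<close>

lemma Up5_induct [case_names cst gen add mult]:
  assumes cst: "\<And>c. S (U_cst c)"
    and gen: "\<And>i j. \<lbrakk>i \<in> {1..5}; j \<in> {1..5}; i \<noteq> j\<rbrakk> \<Longrightarrow> S (Ue i j)"
    and add: "\<And>p q. S p \<Longrightarrow> S q \<Longrightarrow> S (p + q)" and mult: "\<And>p q. S p \<Longrightarrow> S q \<Longrightarrow> S (p * q)"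
  shows "S (p :: 'k::comm_ring_1 Up5)"
proof -
  \<comment> \<open>Brackets become differences of products, so -1 is obtained as a structure
    constant.\<close>
  have zero: "S 0" and one: "S 1" and minus: "S (- 1)"
    using cst[of 0] cst[of 1] cst[of "- 1"] by (simp_all add: ring_hom_simps[OF ring_hom_U_cst])
  have diff: "S (x - y)" if "S x" "S y" for x y
    using add[OF that(1) mult[OF minus that(2)]] by simp
  have lie: "S (U_incl (abs_p5 t))" for t :: "'k lterm"
  proof (induction t)
    case (LGen g)
    obtain i j where g: "Rep_p5gen g = (i, j)" by force
    then have "g = Abs_p5gen (i, j)" using Rep_p5gen_inverse[of g] by simp
    then show ?case
      using gen[of i j] Rep_p5gen[of g] g by (simp add: Ue_def p5e.abs_eq)
  qed (simp_all add: zero_p5_def[symmetric] plus_p5.abs_eq[symmetric] p5_scale.abs_eq[symmetric]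
      p5_br.abs_eq[symmetric] U_incl_zero U_incl_add U_incl_scale U_incl_br zero add mult cst diff)
  have lie': "S (U_incl x)" for x :: "'k p5"
    using lie[of "rep_p5 x"] by (simp add: Quotient3_abs_rep[OF Quotient3_p5])
  have word: "S (abs_Up5 (mon (Word xs)))" for xs :: "'k p5 list"
  proof (induction xs)
    case Nil
    then show ?case using one by (simp add: one_Up5_def zero_word_def[symmetric])
  next
    case (Cons x xs)
    have "abs_Up5 (mon (Word (x # xs))) = U_incl x * abs_Up5 (mon (Word xs))"
      by (simp add: U_incl.abs_eq times_Up5.abs_eq mult_single plus_word_def)
    then show ?case using mult[OF lie' Cons] by simp
  qed
  have "S (abs_Up5 t)" for t
  proof (induction t rule: poly_mapping_add_induct)
    case zero
    then show ?case using \<open>S 0\<close> by (simp only: zero_Up5_def)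
  next
    case (single w c)
    have "abs_Up5 (Poly_Mapping.single w c) = U_cst c * abs_Up5 (mon w)"
      by (simp add: U_cst.abs_eq times_Up5.abs_eq mult_single)
    then show ?case using mult[OF cst word] by (cases w) simp
  next
    case (add x y)
    then show ?case using assms(3) by (simp add: plus_Up5.abs_eq[symmetric])
  qed
  from this[of "rep_Up5 p"] show ?thesis by (simp add: Quotient3_abs_rep[OF Quotient3_Up5])
qed

section \<open>Solving the linear relations for e_34 and e_14, with 2 invertible\<close>

lemma U_halve:
  fixes x y :: "'k::comm_ring_1 Up5"
  assumes "(2 :: 'k) dvd 1" "x + x = y + y"
  shows "x = y"
proof -
  obtain h :: 'k where h: "1 = 2 * h" using assms(1) by (rule dvdE)
  have u: "U_cst h * (z + z) = z" for z
  proof -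
    have "U_cst h * (z + z) = (U_cst h + U_cst h) * z"
      by (simp only: distrib_left distrib_right)
    also have "\<dots> = U_cst (h + h) * z" by (simp only: ring_hom_simps(2)[OF ring_hom_U_cst])
    also have "h + h = 1" by (simp only: mult_2[symmetric] h[symmetric])
    finally show ?thesis by (simp only: ring_hom_simps(1)[OF ring_hom_U_cst] mult_1_left)
  qed
  have "x = U_cst h * (x + x)" by (rule u[symmetric])
  also have "\<dots> = y" unfolding assms(2) by (rule u)
  finally show ?thesis .
qed

lemma Ue_sums:
  shows
  "Ue 1 2 + Ue 1 3 + Ue 1 4 + Ue 1 5 = (0 :: 'k::comm_ring_1 Up5)" "Ue 1 2 + Ue 2 3 + Ue 2 4 + Ue 2 5 = (0 :: 'k Up5)"
  "Ue 1 3 + Ue 2 3 + Ue 3 4 + Ue 3 5 = (0 :: 'k Up5)" "Ue 1 4 + Ue 2 4 + Ue 3 4 + Ue 4 5 = (0 :: 'k Up5)"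
  "Ue 1 5 + Ue 2 5 + Ue 3 5 + Ue 4 5 = (0 :: 'k::comm_ring_1 Up5)"
proof -
  have upt: "[1..<6] = [1, 2, 3, 4, 5::nat]" by (simp add: upt_rec One_nat_def)
  show "Ue 1 2 + Ue 1 3 + Ue 1 4 + Ue 1 5 = 0" using Ue_sum[of 1] by (simp add: upt add.assoc)
  show "Ue 1 2 + Ue 2 3 + Ue 2 4 + Ue 2 5 = 0"
    using Ue_sum[of 2] by (simp add: upt add.assoc Ue_sym[of 2 1])
  show "Ue 1 3 + Ue 2 3 + Ue 3 4 + Ue 3 5 = 0"
    using Ue_sum[of 3] by (simp add: upt add.assoc Ue_sym[of 3 1] Ue_sym[of 3 2])
  show "Ue 1 4 + Ue 2 4 + Ue 3 4 + Ue 4 5 = 0"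
    using Ue_sum[of 4] by (simp add: upt add.assoc Ue_sym[of 4 1] Ue_sym[of 4 2] Ue_sym[of 4 3])
  show "Ue 1 5 + Ue 2 5 + Ue 3 5 + Ue 4 5 = 0"
    using Ue_sum[of 5]
    by (simp add: upt add.assoc Ue_sym[of 5 1] Ue_sym[of 5 2] Ue_sym[of 5 3] Ue_sym[of 5 4])
qed

text \<open>Add the sum relations at 1, 2, 5 and subtract those at 3, 4: generators joining the two
  groups cancel, those inside a group are doubled.\<close>

lemma Ue_34:
  assumes "(2 :: 'k::comm_ring_1) dvd 1"
  shows "(Ue 3 4 :: 'k Up5) = Ue 1 2 + Ue 1 5 + Ue 2 5"
proof (rule U_halve[OF assms])
  have "(Ue 1 2 + Ue 1 5 + Ue 2 5) + (Ue 1 2 + Ue 1 5 + Ue 2 5) - (Ue 3 4 + Ue 3 4 :: 'k Up5) =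
    (Ue 1 2 + Ue 1 3 + Ue 1 4 + Ue 1 5) + (Ue 1 2 + Ue 2 3 + Ue 2 4 + Ue 2 5)
    + (Ue 1 5 + Ue 2 5 + Ue 3 5 + Ue 4 5) - (Ue 1 3 + Ue 2 3 + Ue 3 4 + Ue 3 5)
    - (Ue 1 4 + Ue 2 4 + Ue 3 4 + Ue 4 5)"
    by (simp add: algebra_simps)
  then show "Ue 3 4 + Ue 3 4 = Ue 1 2 + Ue 1 5 + Ue 2 5 + (Ue 1 2 + Ue 1 5 + Ue 2 5 :: 'k Up5)"
    by (simp add: Ue_sums)
qed

text \<open>The same argument with the groups 2, 3, 5 and 1, 4.\<close>

lemma Ue_14:
  assumes "(2 :: 'k::comm_ring_1) dvd 1"
  shows "(Ue 1 4 :: 'k Up5) = Ue 2 3 + Ue 2 5 + Ue 3 5"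
proof (rule U_halve[OF assms])
  have "(Ue 2 3 + Ue 2 5 + Ue 3 5) + (Ue 2 3 + Ue 2 5 + Ue 3 5) - (Ue 1 4 + Ue 1 4 :: 'k Up5) =
    (Ue 1 3 + Ue 2 3 + Ue 3 4 + Ue 3 5) + (Ue 1 2 + Ue 2 3 + Ue 2 4 + Ue 2 5)
    + (Ue 1 5 + Ue 2 5 + Ue 3 5 + Ue 4 5) - (Ue 1 2 + Ue 1 3 + Ue 1 4 + Ue 1 5)
    - (Ue 1 4 + Ue 2 4 + Ue 3 4 + Ue 4 5)"
    by (simp add: algebra_simps)
  then show "Ue 1 4 + Ue 1 4 = Ue 2 3 + Ue 2 5 + Ue 3 5 + (Ue 2 3 + Ue 2 5 + Ue 3 5 :: 'k Up5)"
    by (simp add: Ue_sums)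
qed

text \<open>Substituting for e_34 and e_14 in the commutation relations gives rules that move each
  e_i5 to the right past e_12 and e_23. They have the shape of \<open>rels\<close> in
  \<open>Up5_lift_exists\<close>.\<close>

lemma Ue_rels:
  assumes "(2 :: 'k::comm_ring_1) dvd 1"
  shows "Ue 1 5 * Ue 1 2 = Ue 1 2 * Ue 1 5 + Ue 2 5 * Ue 1 5 - Ue 1 5 * (Ue 2 5 :: 'k Up5)"
    "Ue 2 5 * Ue 1 2 = Ue 1 2 * Ue 2 5 + Ue 1 5 * Ue 2 5 - Ue 2 5 * (Ue 1 5 :: 'k Up5)"
    "Ue 3 5 * Ue 1 2 = Ue 1 2 * (Ue 3 5 :: 'k Up5)"
    "Ue 1 5 * Ue 2 3 = Ue 2 3 * (Ue 1 5 :: 'k Up5)"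
    "Ue 2 5 * Ue 2 3 = Ue 2 3 * Ue 2 5 + Ue 3 5 * Ue 2 5 - Ue 2 5 * (Ue 3 5 :: 'k Up5)"
    "Ue 3 5 * Ue 2 3 = Ue 2 3 * Ue 3 5 + Ue 2 5 * Ue 3 5 - Ue 3 5 * (Ue 2 5 :: 'k Up5)"
  using Ue_comm[of 3 4 1 5, where 'k = 'k] Ue_comm[of 3 4 2 5, where 'k = 'k]
    Ue_comm[of 1 2 3 5, where 'k = 'k] Ue_comm[of 2 3 1 5, where 'k = 'k]
    Ue_comm[of 1 4 2 5, where 'k = 'k] Ue_comm[of 1 4 3 5, where 'k = 'k]
  unfolding Ue_34[OF assms] Ue_14[OF assms] by (simp_all add: algebra_simps)


text \<open>The linear relations express the other five generators through these.\<close>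

lemma Up5_induct5 [consumes 1, case_names cst e12 e23 e15 e25 e35 add mult]:
  assumes two: "(2 :: 'k::comm_ring_1) dvd 1"
    and cst: "\<And>c. S (U_cst c)"
    and gens: "S (Ue 1 2)" "S (Ue 2 3)" "S (Ue 1 5)" "S (Ue 2 5)" "S (Ue 3 5)"
    and add: "\<And>p q. S p \<Longrightarrow> S q \<Longrightarrow> S (p + q)" and mult: "\<And>p q. S p \<Longrightarrow> S q \<Longrightarrow> S (p * q)"
  shows "S (p :: 'k Up5)"
proof (induction p rule: Up5_induct)
  case (gen i j)
  have minus: "S (- x)" if "S x" for x
    using mult[OF cst[of "- 1"] that] by (simp add: ring_hom_simps[OF ring_hom_U_cst])
  have 34: "S (Ue 3 4)" and 14: "S (Ue 1 4)"
    unfolding Ue_34[OF two] Ue_14[OF two] by (intro add gens)+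
  have e45: "(Ue 4 5 :: 'k Up5) = - (Ue 1 5 + Ue 2 5 + Ue 3 5)"
    and e13: "(Ue 1 3 :: 'k Up5) = - (Ue 1 2 + Ue 1 4 + Ue 1 5)"
    and e24: "(Ue 2 4 :: 'k Up5) = - (Ue 1 2 + Ue 2 3 + Ue 2 5)"
    using Ue_sums[where 'k = 'k] by (simp_all add: eq_neg_iff_add_eq_0 algebra_simps)
  have "S (Ue 4 5)" "S (Ue 1 3)" "S (Ue 2 4)"
    unfolding e45 e13 e24 by (intro minus add gens 14)+
  then have "S (Ue i j)" if "i < j" using gen that gens 34 14 unfolding ball_1_5
    by (elim disjE) simp_all
  moreover have "S (Ue i j)" if "j < i" 
    unfolding Ue_sym[OF gen] using \<open>S (Ue 4 5)\<close> \<open>S (Ue 1 3)\<close> \<open>S (Ue 2 4)\<close> gen that gens 34 14 unfolding ball_1_5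
    by (elim disjE) simp_all
  ultimately show ?case using gen(3) by linarith
qed (simp_all add: cst add mult)


section \<open>Square matrices as a ring\<close>

text \<open>A type of its own, so that \<open>*\<close> is the matrix product and matrices can be
  the target ring of \<open>Up5_lift_exists\<close>.\<close>

datatype ('a, 'n) sqmat = Sq (unSq: "'a^'n^'n")

lemma matrix_add_rdistrib: "(A + B) ** C = A ** C + B ** (C :: 'a::semiring_1^'n^'m)"
  by (simp add: matrix_matrix_mult_def vec_eq_iff sum.distrib distrib_right)

instantiation sqmat :: (ring_1, finite) ring_1
begin
definition "0 = Sq 0"
definition "1 = Sq (mat 1)"
definition "A + B = Sq (unSq A + unSq B)"
definition "A - B = Sq (unSq A - unSq B)"
definition "- A = Sq (- unSq A)"
definition "A * B = Sq (unSq A ** unSq B)"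
instance
proof
  show "(0 :: ('a, 'b) sqmat) \<noteq> 1"
    by (auto simp: zero_sqmat_def one_sqmat_def vec_eq_iff mat_def)
qed (auto simp: zero_sqmat_def one_sqmat_def plus_sqmat_def minus_sqmat_def uminus_sqmat_def
    times_sqmat_def matrix_mul_assoc matrix_add_ldistrib matrix_add_rdistrib sqmat.expand)
end

lemma vector_4:
  "(vector [x, y, z, w] :: ('a::zero)^4) $ 1 = x" "(vector [x, y, z, w] :: ('a::zero)^4) $ 2 = y"
  "(vector [x, y, z, w] :: ('a::zero)^4) $ 3 = z" "(vector [x, y, z, w] :: ('a::zero)^4) $ 4 = w"
  unfolding vector_def by simp_all


section \<open>The matrices \<open>\<varpi>(p)\<close>\<close>

text \<open>Read off from \<open>Ue_rels\<close>: row i holds the left coefficients of e_i5 e_12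
  with respect to e_15, e_25, e_35; likewise \<open>varpi23\<close> for e_23.\<close>

definition varpi12 :: "'k::comm_ring_1 Up5^3^3" where
  "varpi12 = vector [vector [Ue 1 2 + Ue 2 5, - Ue 1 5, 0], vector [- Ue 2 5, Ue 1 2 + Ue 1 5, 0],
    vector [0, 0, Ue 1 2]]"

definition varpi23 :: "'k::comm_ring_1 Up5^3^3" where
  "varpi23 = vector [vector [Ue 2 3, 0, 0], vector [0, Ue 2 3 + Ue 3 5, - Ue 2 5],
    vector [0, - Ue 3 5, Ue 2 3 + Ue 2 5]]"

text \<open>
  \<open>p \<mapsto> (p, D(p); 0, \<varpi>(s(pr\<^sub>5 p)))\<close>, where \<open>s\<close> is the section \<open>e\<^sub>0 \<mapsto> e\<^sub>2\<^sub>3\<close>, \<open>e\<^sub>1 \<mapsto> e\<^sub>1\<^sub>2\<close> of \<open>pr\<^sub>5\<close> and \<open>D\<close> is the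
  Fox derivation with \<open>p = s(pr\<^sub>5 p) + \<Sum>\<^sub>j D\<^sub>j(p) e\<^sub>j\<^sub>5\<close>, is an algebra morphism.  It detects the
  coefficients of \<open>\<Sum>\<^sub>j a\<^sub>j e\<^sub>j\<^sub>5\<close>.
\<close>
lemma e5_independent:
  fixes a1 a2 a3 :: "'k::comm_ring_1 Up5"
  assumes two: "(2 :: 'k) dvd 1" and eq: "a1 * Ue 1 5 + a2 * Ue 2 5 + a3 * Ue 3 5 = 0"
  shows "a1 = 0" "a2 = 0" "a3 = 0"
proof -
  define \<eta> :: "'k \<Rightarrow> ('k Up5, 4) sqmat" where "\<eta> c = Sq (mat (U_cst c))" for c
  \<comment> \<open>In blocks of size 1 and 3, \<open>P\<close> and \<open>Q\<close> have lower
    blocks \<open>varpi12\<close> and \<open>varpi23\<close> and zero derivation part. The lower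
    block of each X vanishes since pr_5 kills e_j5, and its derivation part is the j-th unit
    vector.\<close>
  define P Q X1 X2 X3 :: "('k Up5, 4) sqmat" where
    "P = Sq (vector [vector [Ue 1 2, 0, 0, 0], vector [0, Ue 1 2 + Ue 2 5, - Ue 1 5, 0],
      vector [0, - Ue 2 5, Ue 1 2 + Ue 1 5, 0], vector [0, 0, 0, Ue 1 2]])" and
    "Q = Sq (vector [vector [Ue 2 3, 0, 0, 0], vector [0, Ue 2 3, 0, 0],
      vector [0, 0, Ue 2 3 + Ue 3 5, - Ue 2 5], vector [0, 0, - Ue 3 5, Ue 2 3 + Ue 2 5]])" and
    "X1 = Sq (vector [vector [Ue 1 5, 1, 0, 0], 0, 0, 0])" and
    "X2 = Sq (vector [vector [Ue 2 5, 0, 1, 0], 0, 0, 0])" and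
    "X3 = Sq (vector [vector [Ue 3 5, 0, 0, 1], 0, 0, 0])"
  note ops = zero_sqmat_def plus_sqmat_def minus_sqmat_def uminus_sqmat_def times_sqmat_def
    matrix_matrix_mult_def vec_eq_iff forall_4 sum_4 vector_4
  note rels = Ue_rels[OF two]
  have \<eta>: "ring_hom \<eta>"
    by (simp add: ring_hom_def \<eta>_def one_sqmat_def ring_hom_simps[OF ring_hom_U_cst] ops mat_def)
  have central: "\<eta> c * A = A * \<eta> c" for c A
    by (cases A) (simp add: \<eta>_def ops mat_def U_cst_central)
  have "X1 * P = P * X1 + X2 * X1 - X1 * X2" "X2 * P = P * X2 + X1 * X2 - X2 * X1" "X3 * P = P * X3"
    "X1 * Q = Q * X1" "X2 * Q = Q * X2 + X3 * X2 - X2 * X3" "X3 * Q = Q * X3 + X2 * X3 - X3 * X2"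
    by (simp_all add: P_def Q_def X1_def X2_def X3_def ops rels)
  from Up5_lift_exists[OF \<eta> central this] obtain \<Phi> :: "'k Up5 \<Rightarrow> ('k Up5, 4) sqmat"
    where \<Phi>: "ring_hom \<Phi>" "\<Phi> (Ue 1 2) = P" "\<Phi> (Ue 2 3) = Q"
      "\<Phi> (Ue 1 5) = X1" "\<Phi> (Ue 2 5) = X2" "\<Phi> (Ue 3 5) = X3"
      "\<And>c. \<Phi> (U_cst c) = \<eta> c"
    by blast
  have \<Phi>_cst: "\<Phi> (U_cst c) = \<eta> c" for c by (rule \<Phi>(7))
  let ?c = "\<lambda>p i. unSq (\<Phi> p) $ i $ 1"
  \<comment> \<open>The first column of \<open>\<Phi> p\<close> is (p, 0, 0, 0), the left part of
    the triangular shape.\<close>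
  have corner: "?c p 1 = p \<and> ?c p 2 = 0 \<and> ?c p 3 = 0 \<and> ?c p 4 = 0" for p
    using two
    by (induction p rule: Up5_induct5)
      (simp_all add: \<Phi> \<Phi>_cst \<eta>_def mat_def P_def Q_def X1_def X2_def X3_def vector_4
        ring_hom_simps[OF \<Phi>(1)] plus_sqmat_def times_sqmat_def matrix_matrix_mult_def sum_4)
  \<comment> \<open>Each X is concentrated in its first row, so the first row of
    \<open>\<Phi> a1 * X1\<close> is \<open>a1\<close> times that of \<open>X1\<close>, and
    similarly for the others; columns 2 to 4 isolate the three coefficients.\<close>
  have "\<Phi> a1 * X1 + \<Phi> a2 * X2 + \<Phi> a3 * X3 = 0"
    using arg_cong[OF eq, of \<Phi>] by (simp add: ring_hom_simps[OF \<Phi>(1)] \<Phi>)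
  then have "unSq (\<Phi> a1 * X1 + \<Phi> a2 * X2 + \<Phi> a3 * X3) $ 1 $ j = 0" for j
    by (simp add: zero_sqmat_def)
  from this[of 2] this[of 3] this[of 4] show "a1 = 0" "a2 = 0" "a3 = 0"
    by (simp_all add: X1_def X2_def X3_def plus_sqmat_def times_sqmat_def matrix_matrix_mult_def
        sum_4 vector_4 corner)
qed

text \<open>\<open>e5_independent\<close>, applied to the difference of two candidate rows, supplies
  the uniqueness behind the definite description.\<close>

lemma varpi_eqI:
  fixes A :: "'k::comm_ring_1 Up5^3^3"
  assumes two: "(2 :: 'k) dvd 1" and A: "\<And>i. e5 $ i * p = (\<Sum>j\<in>UNIV. A $ i $ j * e5 $ j)"
  shows "varpi p = A"
  unfolding varpi_def
proof (rule the_equality)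
  fix B :: "'k Up5^3^3"
  assume B: "\<forall>i. e5 $ i * p = (\<Sum>j\<in>UNIV. B $ i $ j * e5 $ j)"
  have "B $ i $ 1 - A $ i $ 1 = 0 \<and> B $ i $ 2 - A $ i $ 2 = 0 \<and> B $ i $ 3 - A $ i $ 3 = 0" for i
  proof -
    have "(B $ i $ 1 - A $ i $ 1) * Ue 1 5 + (B $ i $ 2 - A $ i $ 2) * Ue 2 5
      + (B $ i $ 3 - A $ i $ 3) * Ue 3 5 = 0"
      using B A[of i] by (simp add: sum_3 e5_def algebra_simps)
    from e5_independent[OF two this] show ?thesis by blast
  qed
  then show "B = A" by (simp add: vec_eq_iff forall_3)
qed (use A in blast)

text \<open>Existence is tracked apart from uniqueness: it spreads by sums and products from
  constants, \<open>Ue 1 2\<close> and \<open>Ue 2 3\<close> to the whole image of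
  \<open>ell\<close>.\<close>

definition has_varpi :: "'k::comm_ring_1 Up5 \<Rightarrow> bool" where
  "has_varpi p \<longleftrightarrow> (\<exists>A. \<forall>i. e5 $ i * p = (\<Sum>j\<in>UNIV. A $ i $ j * e5 $ j))"

context
  assumes two: "(2 :: 'k::comm_ring_1) dvd 1"
begin

lemma varpi_props:
  assumes "has_varpi (p :: 'k Up5)"
  shows "e5 $ i * p = (\<Sum>j\<in>UNIV. varpi p $ i $ j * e5 $ j)"
  using assms varpi_eqI[OF two, of p] unfolding has_varpi_def by metis

lemma varpi_add:
  assumes "has_varpi (p :: 'k Up5)" "has_varpi q"
  shows "varpi (p + q) = varpi p + varpi q" "has_varpi (p + q)"
proof -
  have *: "e5 $ i * (p + q) = (\<Sum>j\<in>UNIV. (varpi p + varpi q) $ i $ j * e5 $ j)" for i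
    by (simp add: distrib_left distrib_right varpi_props[OF assms(1)] varpi_props[OF assms(2)] sum.distrib)
  show "varpi (p + q) = varpi p + varpi q" by (rule varpi_eqI[OF two *])
  show "has_varpi (p + q)" unfolding has_varpi_def using * by blast
qed

text \<open>Moving e_i5 first past p and then past q multiplies the coefficient matrices in the same
  order.\<close>

lemma varpi_mult:
  assumes "has_varpi (p :: 'k Up5)" "has_varpi q"
  shows "varpi (p * q) = varpi p ** varpi q" "has_varpi (p * q)"
proof -
  have *: "e5 $ i * (p * q) = (\<Sum>j\<in>UNIV. (varpi p ** varpi q) $ i $ j * e5 $ j)" for i
  proof -
    have "e5 $ i * (p * q) = (\<Sum>k\<in>UNIV. varpi p $ i $ k * (e5 $ k * q))"
      by (simp only: mult.assoc[symmetric] varpi_props[OF assms(1)] sum_distrib_right)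
    also have "\<dots> = (\<Sum>k\<in>UNIV. \<Sum>j\<in>UNIV. varpi p $ i $ k * varpi q $ k $ j * e5 $ j)"
      by (simp only: varpi_props[OF assms(2)] sum_distrib_left mult.assoc)
    also have "\<dots> = (\<Sum>j\<in>UNIV. (varpi p ** varpi q) $ i $ j * e5 $ j)"
      unfolding matrix_matrix_mult_def by (subst sum.swap) (simp add: sum_distrib_right)
    finally show ?thesis .
  qed
  show "varpi (p * q) = varpi p ** varpi q" by (rule varpi_eqI[OF two *])
  show "has_varpi (p * q)" unfolding has_varpi_def using * by blast
qed

lemma varpi_cst: "varpi (U_cst (c :: 'k)) = mat (U_cst c)" "has_varpi (U_cst c)"
proof -
  have *: "e5 $ i * U_cst c = (\<Sum>j\<in>UNIV. (mat (U_cst c) :: 'k Up5^3^3) $ i $ j * e5 $ j)" for i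
    by (simp add: mat_def U_cst_central if_distrib[of "\<lambda>x. x * _"] cong: if_cong)
  show "varpi (U_cst c) = mat (U_cst c)" by (rule varpi_eqI[OF two *])
  show "has_varpi (U_cst c)" unfolding has_varpi_def using * by blast
qed

lemma varpi_e12: "varpi (Ue 1 2 :: 'k Up5) = varpi12" "has_varpi (Ue 1 2 :: 'k Up5)"
proof -
  have "\<forall>i. e5 $ i * Ue 1 2 = (\<Sum>j\<in>UNIV. (varpi12 :: 'k Up5^3^3) $ i $ j * e5 $ j)"
    by (simp add: forall_3 sum_3 e5_def varpi12_def Ue_rels[OF two] algebra_simps)
  then show "varpi (Ue 1 2 :: 'k Up5) = varpi12" "has_varpi (Ue 1 2 :: 'k Up5)"
    using varpi_eqI[OF two, of "Ue 1 2" varpi12] unfolding has_varpi_def by blast+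
qed

lemma varpi_e23: "varpi (Ue 2 3 :: 'k Up5) = varpi23" "has_varpi (Ue 2 3 :: 'k Up5)"
proof -
  have "\<forall>i. e5 $ i * Ue 2 3 = (\<Sum>j\<in>UNIV. (varpi23 :: 'k Up5^3^3) $ i $ j * e5 $ j)"
    by (simp add: forall_3 sum_3 e5_def varpi23_def Ue_rels[OF two] algebra_simps)
  then show "varpi (Ue 2 3 :: 'k Up5) = varpi23" "has_varpi (Ue 2 3 :: 'k Up5)"
    using varpi_eqI[OF two, of "Ue 2 3" varpi23] unfolding has_varpi_def by blast+
qed

end


section \<open>Induction over free algebras\<close>

lemma free_algebra_induct [case_names cst gen add mult]:
  assumes cst: "\<And>c. S (cst c)" and gen: "\<And>g. S (mon (Word [g]))"
    and add: "\<And>x y. S x \<Longrightarrow> S y \<Longrightarrow> S (x + y)" and mult: "\<And>x y. S x \<Longrightarrow> S y \<Longrightarrow> S (x * y)"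
  shows "S (x :: 'g word \<Rightarrow>\<^sub>0 'k::comm_ring_1)"
proof (induction x rule: poly_mapping_add_induct)
  case zero
  show ?case using cst[of 0] by simp
next
  case (single w c)
  have "S (Poly_Mapping.single (Word gs) c)" for gs
  proof (induction gs)
    case Nil
    then show ?case using cst[of c] by (simp add: zero_word_def)
  next
    case (Cons g gs)
    have "Poly_Mapping.single (Word (g # gs)) c = mon (Word [g]) * Poly_Mapping.single (Word gs) c"
      by (simp add: mult_single plus_word_def)
    then show ?case using mult[OF gen Cons] by simp
  qed
  then show ?case by (cases w) simp
qed (rule add)

lemma mlift_word_prod_gen:
  "ring_hom \<eta> \<Longrightarrow> mlift \<eta> (word_prod f) (mon (Word [g])) = f g"
  by (simp add: mlift_single word_prod_def ring_hom_simps)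


section \<open>The morphism \<open>\<rho>\<close>\<close>

lemma tens_inl_inr: "tens x 1 = inl x" "tens 1 y = inr y"
  by (simp_all add: tens_def ring_hom_simps[OF ring_hom_inl] ring_hom_simps[OF ring_hom_inr])

lemma tens_minus: "tens (- x) y = - tens x y" "tens x (- y) = - tens x y"
  by (simp_all add: tens_def ring_hom_simps[OF ring_hom_inl] ring_hom_simps[OF ring_hom_inr])

lemma ring_hom_pr12: "ring_hom (pr12 :: 'k::comm_ring_1 Up5 \<Rightarrow> 'k V2)"
proof -
  have f: "ring_hom (U_eval pr12_lie :: _ \<Rightarrow> 'k V2)"
    by (intro ring_hom_mlift_cst word_prod_simps)
  show ?thesis
    unfolding ring_hom_def
    by (intro conjI allI; transfer; simp add: ring_hom_simps[OF f])
qed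

lemma pr12_cst: "pr12 (U_cst c) = cst c"
  by transfer (simp add: mlift_single[OF ring_hom_cst] word_prod_simps)

lemma pr12_Ue:
  assumes "i \<in> {1..5}" "j \<in> {1..5}" "i \<noteq> j"
  shows "pr12 (Ue i j) = (inl (pr1_gen (i, j)) + inr (pr2_gen (i, j)) :: 'k::comm_ring_1 V2)"
proof -
  have 1: "pr1 (Ue i j) = (pr1_gen (i, j) :: 'k V)"
    using assms by (simp add: Ue_def U_incl.abs_eq p5e.abs_eq pr1.abs_eq pr1_lie.abs_eq
        mlift_word_prod_gen[OF ring_hom_cst] Abs_p5gen_inverse)
  have 2: "pr2 (Ue i j) = (pr2_gen (i, j) :: 'k V)"
    using assms by (simp add: Ue_def U_incl.abs_eq p5e.abs_eq pr2.abs_eq pr2_lie.abs_eq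
        mlift_word_prod_gen[OF ring_hom_cst] Abs_p5gen_inverse)
  have "pr12 (Ue i j) = (pr12_lie (p5e i j) :: 'k V2)"
    by (simp add: Ue_def U_incl.abs_eq pr12.abs_eq mlift_word_prod_gen[OF ring_hom_cst])
  then show ?thesis using 1 2 by (simp add: pr12_lie_def Ue_def tens_inl_inr)
qed

lemma pr12_values:
  "pr12 (Ue 1 2) = (0 :: 'k::comm_ring_1 V2)" "pr12 (Ue 2 3) = (inl e0 :: 'k V2)"
  "pr12 (Ue 1 5) = (inr e1 :: 'k V2)" "pr12 (Ue 2 5) = (inl e1 :: 'k V2)"
  "pr12 (Ue 3 5) = (- inl e0 - inl e1 + inr e0 :: 'k V2)"
  by (simp_all add: pr12_Ue pr1_gen_def pr2_gen_def doubleton_eq_iff einf_def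
      ring_hom_simps[OF ring_hom_inl] ring_hom_simps[OF ring_hom_inr])

lemma ring_hom_ell: "ring_hom ell"
  unfolding ell_def
  by (intro ring_hom_mlift ring_hom_U_cst U_cst_central word_prod_simps)

lemma ell_values: "ell (cst c) = U_cst c" "ell e0 = Ue 2 3" "ell e1 = Ue 1 2"
proof -
  show "ell (cst c) = U_cst c" by (simp add: ell_def mlift_single[OF ring_hom_U_cst] word_prod_simps)
  show "ell e0 = Ue 2 3" "ell e1 = Ue 1 2"
    by (simp_all add: ell_def e0_def e1_def mlift_word_prod_gen[OF ring_hom_U_cst])
qed

lemma V_induct [case_names cst e0 e1 add mult]:
  assumes "\<And>c. S (cst c)" "S e0" "S e1"
    and "\<And>x y. S x \<Longrightarrow> S y \<Longrightarrow> S (x + y)" "\<And>x y. S x \<Longrightarrow> S y \<Longrightarrow> S (x * y)"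
  shows "S (x :: 'k::comm_ring_1 V)"
proof (induction x rule: free_algebra_induct)
  case (gen g)
  show ?case using assms(2,3) by (cases g) (simp_all add: e0_def e1_def)
qed (use assms in auto)

context
  assumes two: "(2 :: 'k::comm_ring_1) dvd 1"
begin

lemma has_varpi_ell: "has_varpi (ell (a :: 'k V))"
  by (induction a rule: V_induct)
    (simp_all add: ell_values ring_hom_simps[OF ring_hom_ell] two varpi_cst varpi_e12 varpi_e23
      varpi_add varpi_mult)

lemma rho_add: "rho (a + b :: 'k V) = rho a + rho b"
  by (simp add: rho_def vec_eq_iff ring_hom_simps[OF ring_hom_ell] varpi_add[OF two] has_varpi_ell
      ring_hom_simps[OF ring_hom_pr12])

lemma rho_mult: "rho (a * b :: 'k V) = rho a ** rho b"
  by (simp add: rho_def vec_eq_iff ring_hom_simps[OF ring_hom_ell] varpi_mult[OF two] has_varpi_ell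
      ring_hom_simps[OF ring_hom_pr12] matrix_matrix_mult_def ring_hom_sum[OF ring_hom_pr12])

lemma rho_cst: "rho (cst c :: 'k V) = mat (cst c)"
  by (simp add: rho_def vec_eq_iff ell_values varpi_cst[OF two] mat_def pr12_cst
      ring_hom_simps[OF ring_hom_pr12])

text \<open>As \<open>pr12\<close> kills e_12, only the images of e_15 and e_25 remain, which is why
  the matrix factors through \<open>row1\<close>.\<close>

lemma rho_e1: "rho (e1 :: 'k V) = vector [vector [inl e1, - inr e1, 0],
    vector [- inl e1, inr e1, 0], vector [0, 0, 0]]"
  by (simp add: rho_def vec_eq_iff forall_3 ell_values varpi_e12[OF two] varpi12_def pr12_values
      ring_hom_simps[OF ring_hom_pr12])

lemma rho_e0: "rho (e0 :: 'k V) = vector [vector [inl e0, 0, 0],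
    vector [0, inr e0 - inl e1, - inl e1], vector [0, inl e0 + inl e1 - inr e0, inl e0 + inl e1]]"
  by (simp add: rho_def vec_eq_iff forall_3 ell_values varpi_e23[OF two] varpi23_def pr12_values
      ring_hom_simps[OF ring_hom_pr12])

end


declare One_nat_def [simp]

section \<open>Rows and columns\<close>

definition row_mult :: "'a::ring_1^'n::finite \<Rightarrow> 'a^'m^'n \<Rightarrow> 'a^'m" where
  "row_mult r A = (\<chi> j. \<Sum>i\<in>UNIV. r $ i * A $ i $ j)"

lemma row_mult_add: "row_mult (r + s) A = row_mult r A + row_mult s A"
  "row_mult r (A + B) = row_mult r A + row_mult r B"
  by (simp_all add: row_mult_def vec_eq_iff distrib_left distrib_right sum.distrib)

lemma row_mult_assoc: "row_mult r (A ** B) = row_mult (row_mult r A) B"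
  by (simp add: row_mult_def vec_eq_iff matrix_matrix_mult_def sum_distrib_left sum_distrib_right
      mult.assoc) (subst sum.swap, simp)

lemma row_mult_smult: "row_mult (\<chi> i. c * r $ i) A = (\<chi> j. c * row_mult r A $ j)"
  by (simp add: row_mult_def sum_distrib_left mult.assoc)

lemma row_mult_mat_cst: "row_mult r (mat (cst c)) = (\<chi> j. cst c * r $ j)"
  by (simp add: row_mult_def mat_def cst_central if_distrib[of "\<lambda>x. _ * x"] cong: if_cong)

section \<open>The map \<open>rowcol\<close>, computed before passing to the quotient\<close>

lemma qclass_zero: "qclass 0 = 0"
  using qclass_simps(1)[of 0 0] by simp

lemma qclass_minus: "qclass (- x) = - qclass x"
  using qclass_simps(1)[of x "- x"] by (simp add: qclass_zero eq_neg_iff_add_eq_0 add.commute)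

lemma qclass_sum: "qclass (sum f S) = (\<Sum>x\<in>S. qclass (f x))"
  by (induction S rule: infinite_finite_induct) (simp_all add: qclass_zero qclass_simps)

lemma act_zero: "a \<rhd> 0 = 0"
  using act_simps(2)[of a 0 0] by simp

lemma act_sum: "a \<rhd> (\<Sum>x\<in>S. f x) = (\<Sum>x\<in>S. a \<rhd> f x)"
  by (induction S rule: infinite_finite_induct) (simp_all add: act_zero act_simps)

lemma one_DR2_eq: "one_DR2 = qclass 1"
  unfolding one_DR2_def one_DR_def
  by transfer (simp add: tens_inl_inr ring_hom_simps[OF ring_hom_inl] left_ideal_zero)

text \<open>A lift of \<open>col0\<close> to \<open>V2\<close>: products are computed in an algebra
  and the class is taken only at the end.\<close>

definition colV :: "'k::comm_ring_1 V2^3" where "colV = vector [0, - inl e1, inl e1]"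

lemma col0_eq: "col0 $ j = qclass (colV $ j)"
proof -
  have "\<forall>j. col0 $ j = qclass (colV $ j)"
    by (simp add: forall_3 col0_def colV_def one_DR2_eq qclass_zero qclass_minus tens_inl_inr
        qclass_simps(2)[symmetric])
  then show ?thesis ..
qed

definition row_col :: "'k::comm_ring_1 V2^3 \<Rightarrow> 'k V2" where
  "row_col r = (\<Sum>j\<in>UNIV. r $ j * colV $ j)"

lemma ring_hom_loc_V2: "ring_hom loc_V2"
  unfolding loc_V2_def by (rule ring_hom_mon_map[OF loc_word2_simps])

lemma loc_M2_qclass: "loc_M2 (qclass x) = qclass (loc_V2 x)"
  unfolding loc_V2_def by transfer (simp add: left_ideal_zero)

lemma rowcol_sum: "rowcol m = (\<Sum>i\<in>UNIV. \<Sum>j\<in>UNIV.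
    qclass (e1f1_inv * loc_V2 (row1 $ i * m $ i $ j * colV $ j)))"
  by (simp add: rowcol_def col0_eq loc_M2_qclass qclass_simps(2) act_sum
      ring_hom_simps(3)[OF ring_hom_loc_V2] act_simps(3))

lemma rowcol_eq: "rowcol m = qclass (e1f1_inv * loc_V2 (row_col (row_mult row1 m)))"
  unfolding rowcol_sum row_col_def row_mult_def
  by (subst sum.swap)
    (simp add: ring_hom_sum[OF ring_hom_loc_V2] sum_distrib_left sum_distrib_right qclass_sum)

lemma inr_mult_inl: "inr y * inl x = inl x * inr y"
  by (rule inl_inr_commute[symmetric])

lemma row_col_smult: "row_col (\<chi> i. c * r $ i) = c * row_col r"
  by (simp add: row_col_def sum_distrib_left mult.assoc)

lemma row_col_add: "row_col (r + s) = row_col r + row_col s"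
  by (simp add: row_col_def sum.distrib distrib_right)

lemma row_col_row1: "row_col row1 = tens e1 (e1 :: 'k::comm_ring_1 V)"
  by (simp add: row_col_def row1_def colV_def sum_3 inr_mult_inl tens_def
      ring_hom_simps[OF ring_hom_inl] ring_hom_simps[OF ring_hom_inr])

text \<open>The product of \<open>rho e0\<close> with \<open>colV\<close> is the column (0, -1, 1)
  times e_1 f_0. Since f_0 commutes with e_1 it can stand on the right, where passing to the
  quotient kills it.\<close>

lemma row_col_rho_e0:
  assumes "(2 :: 'k::comm_ring_1) dvd 1"
  shows "\<exists>z. row_col (row_mult r (rho (e0 :: 'k V))) = z * inr e0"
proof
  show "row_col (row_mult r (rho e0)) = (r $ 3 - r $ 2) * inl e1 * inr e0"
    by (simp add: row_col_def row_mult_def rho_e0[OF assms] colV_def sum_3 inr_mult_inl algebra_simps)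
qed

lemma e1f1_inv_cancel: "e1f1_inv * (loc_V2 (tens e1 e1) * x) = (x :: 'k::comm_ring_1 Vloc2)"
proof -
  have "lletter L1inv + loc_word (Word [E1]) = 0"
    unfolding loc_word_def
    by (simp, transfer) (simp add: loc_cong_left_inv)
  then have "e1f1_inv * loc_V2 (tens e1 e1) = (1 :: 'k Vloc2)"
    by (simp add: e1f1_inv_def e1_def tens_single loc_V2_def loc_word2_def mult_single zero_prod_def[symmetric])
  then show ?thesis by (simp add: mult.assoc[symmetric])
qed

text \<open>The scalar c_n of the overview, for n = m + 1.\<close>

definition row_coeff :: "nat \<Rightarrow> 'k::comm_ring_1 V2" where
  "row_coeff m = (\<Sum>k<m. tens (e1 * e0 ^ k) (e1 * e0 ^ (m - Suc k)))
     - tens (e1 * e0 ^ m) 1 - tens 1 (e1 * e0 ^ m)"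

section \<open>The rows obtained from powers of e_0 and from the y_n\<close>

lemma row_mult_rho_e0:
  assumes "(2 :: 'k::comm_ring_1) dvd 1"
  shows "row_mult r (rho (e0 :: 'k V)) = vector [r $ 1 * inl e0,
    r $ 2 * (inr e0 - inl e1) + r $ 3 * (inl e0 + inl e1 - inr e0),
    r $ 3 * (inl e0 + inl e1) - r $ 2 * inl e1]"
  by (simp add: row_mult_def rho_e0[OF assms] vec_eq_iff forall_3 sum_3 algebra_simps)

text \<open>Multiplication by \<open>rho e0\<close> sends r3 - r2 to (r3 - r2) f_0 and r3 to r3 e_0
  + (r3 - r2) e_1. Hence r3 - r2 is \<open>tens 1 (e1 * e0 ^ m)\<close>, and times e_1 it is the new
  summand k = 0 of r3.\<close>

lemma row1_rho_e0_power:
  fixes m :: nat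
  assumes two: "(2 :: 'k::comm_ring_1) dvd 1"
  defines "r \<equiv> row_mult row1 (rho (e0 ^ m :: 'k V))"
  shows "r $ 1 = tens (e1 * e0 ^ m) 1 \<and>
    r $ 2 = (\<Sum>k<m. tens (e1 * e0 ^ k) (e1 * e0 ^ (m - Suc k))) - tens 1 (e1 * e0 ^ m) \<and>
    r $ 3 = (\<Sum>k<m. tens (e1 * e0 ^ k) (e1 * e0 ^ (m - Suc k)))"
  unfolding r_def
proof (induction m)
  case 0
  have "rho (e0 ^ 0 :: 'k V) = mat (cst 1)" using rho_cst[OF two, of 1] by simp
  then show ?case by (simp only: row_mult_mat_cst) (simp add: row1_def)
next
  case (Suc m)
  let ?r = "row_mult row1 (rho (e0 ^ m :: 'k V))"
  let ?S = "\<Sum>k<m. tens (e1 * e0 ^ k) (e1 * e0 ^ (m - Suc k)) :: 'k V2"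
  \<comment> \<open>The summand k = 0 is split off; the shifted ones are the old summands times e_0
    in the first tensor factor.\<close>
  have S: "(\<Sum>k<Suc m. tens (e1 * e0 ^ k) (e1 * e0 ^ (Suc m - Suc k))) = tens e1 (e1 * e0 ^ m) + ?S * inl (e0 :: 'k V)"
    unfolding sum.lessThan_Suc_shift
    by (simp add: sum_distrib_right tens_inl_inr(1)[symmetric] tens_mult mult.assoc power_commutes)
  have *: "row_mult row1 (rho (e0 ^ Suc m :: 'k V)) = row_mult ?r (rho e0)"
    unfolding power_Suc2 rho_mult[OF two] row_mult_assoc ..
  have T: "tens 1 (e1 * e0 ^ m) * inl e1 = tens e1 (e1 * e0 ^ m :: 'k V)"
    "tens 1 (e1 * e0 ^ m) * inr e0 = tens 1 (e1 * e0 ^ Suc m :: 'k V)"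
    "tens (e1 * e0 ^ m) 1 * inl e0 = tens (e1 * e0 ^ Suc m :: 'k V) 1"
    by (simp_all add: tens_inl_inr[symmetric] tens_mult mult.assoc power_commutes)
  show ?case
    unfolding * S row_mult_rho_e0[OF two] Suc[THEN conjunct1] Suc[THEN conjunct2, THEN conjunct1]
      Suc[THEN conjunct2, THEN conjunct2]
    by (simp add: T algebra_simps del: power_Suc)
qed

lemma row_mult_rho_e1:
  assumes "(2 :: 'k::comm_ring_1) dvd 1"
  shows "row_mult r (rho (e1 :: 'k V)) = (\<chi> j. (r $ 1 - r $ 2) * row1 $ j)"
  by (simp add: row_mult_def rho_e1[OF assms] row1_def vec_eq_iff forall_3 sum_3 tens_inl_inr
      algebra_simps)

lemma row1_rho_ygen:
  assumes two: "(2 :: 'k::comm_ring_1) dvd 1"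
  shows "row_mult row1 (rho (ygen (Suc m) :: 'k V)) = (\<chi> j. row_coeff m * row1 $ j)"
proof -
  \<comment> \<open>The sign becomes a central scalar on the right, where \<open>rho_cst\<close> and
    \<open>row_mult_mat_cst\<close> absorb it.\<close>
  have "ygen (Suc m) = (e0 ^ m * e1) * (cst (- 1) :: 'k V)"
    by (simp add: ygen_def single_uminus)
  then have "row_mult row1 (rho (ygen (Suc m) :: 'k V))
    = (\<chi> j. cst (- 1) * row_mult (row_mult row1 (rho (e0 ^ m))) (rho e1) $ j)"
    by (simp only: rho_mult[OF two] rho_cst[OF two] row_mult_assoc row_mult_mat_cst)
  then show ?thesis
    using row1_rho_e0_power[OF two, of m]
    by (simp add: row_mult_rho_e1[OF two] row_coeff_def single_uminus algebra_simps)
qed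

text \<open>In each tensor factor (e_1 e_0^k) e_1 = e_1 (e_0^k e_1), and e_0^k e_1 is -y_(k+1). The
  signs cancel in the mixed terms and account for the minus signs of the other two.\<close>

lemma row_coeff_conjugate:
  "row_coeff m * tens e1 e1 = tens e1 e1 * (\<Delta>y (Suc m) :: 'k::comm_ring_1 V2)"
proof -
  have "(\<Sum>k = 1..m. tens (ygen k) (ygen (Suc m - k))) =
      (\<Sum>k<m. tens (e0 ^ k * e1) (e0 ^ (m - Suc k) * e1) :: 'k V2)"
    unfolding sum_bounds_lt_plus1[symmetric]
    by (intro sum.cong refl) (simp add: ygen_def tens_minus)
  then show ?thesis
    by (simp add: row_coeff_def \<Delta>y_def ygen_def tens_minus tens_mult algebra_simps
        sum_distrib_left sum_distrib_right mult.assoc)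
qed


section \<open>Free generation of \<open>W\<close> and the coproduct\<close>

lemma ring_hom_Y_eval: "ring_hom Y_eval"
  unfolding Y_eval_def by (intro ring_hom_mlift_cst word_prod_simps)

text \<open>Letter n stands for y_(n+1), whence n copies of \<open>E0\<close> before each
  \<open>E1\<close>.\<close>

primrec y_word :: "nat list \<Rightarrow> gen list" where
  "y_word [] = []"
| "y_word (n # ns) = replicate n E0 @ E1 # y_word ns"

lemma replicate_E0_eq_iff: "replicate n E0 @ E1 # us = replicate m E0 @ E1 # vs \<longleftrightarrow> n = m \<and> us = vs"
  by (induction n arbitrary: m; case_tac m) auto

lemma y_word_inject: "y_word ms = y_word ns \<longleftrightarrow> ms = ns"
  by (induction ms arbitrary: ns; case_tac ns) (simp_all add: replicate_E0_eq_iff)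

text \<open>The decomposition of V into V e_0 and W on the level of words: a word not ending in
  \<open>E0\<close> can be cut after each \<open>E1\<close>.\<close>

lemma word_cases:
  obtains us where "ls = us @ [E0]" | ns where "ls = y_word ns"
proof -
  have "(\<exists>us. ls = us @ [E0]) \<or> (\<exists>ns. ls = y_word ns)"
  proof (induction ls)
    case Nil
    have "[] = y_word []" by simp
    then show ?case by blast
  next
    case (Cons g ls)
    show ?case
    proof (cases "\<exists>us. ls = us @ [E0]")
      case True
      then show ?thesis by (metis append_Cons)
    next
      case False
      then obtain ns where ns: "ls = y_word ns" using Cons by blast
      show ?thesis
      proof (cases g)
        case E1
        then have "g # ls = y_word (0 # ns)" by (simp add: ns)
        then show ?thesis by blast
      next
        case E0
        show ?thesis
        proof (cases ns)
          case Nil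
          then have "g # ls = [] @ [E0]" by (simp add: ns E0)
          then show ?thesis by blast
        next
          case (Cons n ns')
          then have "g # ls = y_word (Suc n # ns')" by (simp add: ns E0)
          then show ?thesis by blast
        qed
      qed
    qed
  qed
  then show thesis using that by blast
qed

lemma e0_power: "e0 ^ n = mon (Word (replicate n E0))"
  by (induction n) (simp_all add: e0_def mult_single plus_word_def zero_word_def[symmetric])

lemma ygen_Suc: "ygen (Suc n) = Poly_Mapping.single (Word (replicate n E0 @ [E1])) (- 1)"
  by (simp add: ygen_def e0_power e1_def mult_single plus_word_def single_uminus)

lemma free_mlift_Cons:
  "mlift cst (word_prod f) (Poly_Mapping.single (Word (g # gs)) c)
    = f g * mlift cst (word_prod f) (Poly_Mapping.single (Word gs) c)"
  by (simp add: mlift_single[OF ring_hom_cst] word_prod_def cst_left_commute)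

lemma Y_eval_single:
  "Y_eval (Poly_Mapping.single (Word ns) c) = Poly_Mapping.single (Word (y_word ns)) ((- 1) ^ length ns * c)"
proof (induction ns)
  case Nil
  show ?case
    by (simp add: Y_eval_def mlift_single[OF ring_hom_cst] word_prod_simps zero_word_def[symmetric])
next
  case (Cons n ns)
  have "Y_eval (Poly_Mapping.single (Word (n # ns)) c) = ygen (Suc n) * Y_eval (Poly_Mapping.single (Word ns) c)"
    unfolding Y_eval_def by (rule free_mlift_Cons)
  then show ?case by (simp add: Cons ygen_Suc mult_single plus_word_def)
qed

text \<open>Up to sign, \<open>Y_eval\<close> sends basis words to distinct basis words, so
  coefficients can be read back. This is the freeness of the y_n.\<close>

lemma lookup_Y_eval:
  "Poly_Mapping.lookup (Y_eval x) (Word (y_word ns)) = (- 1) ^ length ns * Poly_Mapping.lookup x (Word ns)"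
proof (induction x rule: poly_mapping_add_induct)
  case (single w c)
  then show ?case
    by (cases w) (auto simp: Y_eval_single lookup_single when_def y_word_inject)
qed (simp_all add: ring_hom_simps[OF ring_hom_Y_eval] lookup_add distrib_left)

lemma inj_Y_eval: "inj (Y_eval :: (nat word \<Rightarrow>\<^sub>0 'k::comm_ring_1) \<Rightarrow> 'k V)"
proof (rule injI)
  fix x y :: "nat word \<Rightarrow>\<^sub>0 'k" assume eq: "Y_eval x = Y_eval y"
  show "x = y"
  proof (rule poly_mapping_eqI)
    fix w
    have "(- 1) ^ length (letters w) * Poly_Mapping.lookup x w = (- 1) ^ length (letters w) * Poly_Mapping.lookup y w"
      using lookup_Y_eval[of x "letters w"] lookup_Y_eval[of y "letters w"] eq by simp
    then show "Poly_Mapping.lookup x w = Poly_Mapping.lookup y w"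
      by (cases "even (length (letters w))") simp_all
  qed
qed

section \<open>The intersection of W and V e_0\<close>

lemma lookup_mult_letter:
  fixes x :: "'g word \<Rightarrow>\<^sub>0 'k::comm_ring_1"
  shows
  "Poly_Mapping.lookup (x * mon (Word [g])) (Word (ls @ [h])) = (if g = h then Poly_Mapping.lookup x (Word ls) else 0)"
  "Poly_Mapping.lookup (x * mon (Word [g])) (Word []) = 0"
proof -
  show "Poly_Mapping.lookup (x * mon (Word [g])) (Word (ls @ [h])) = (if g = h then Poly_Mapping.lookup x (Word ls) else 0)"
  proof (induction x rule: poly_mapping_add_induct)
    case (single w c)
    then show ?case by (cases w) (auto simp: mult_single plus_word_def lookup_single when_def)
  qed (auto simp: distrib_right lookup_add)
  show "Poly_Mapping.lookup (x * mon (Word [g])) (Word []) = 0"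
  proof (induction x rule: poly_mapping_add_induct)
    case (single w c)
    then show ?case by (cases w) (auto simp: mult_single plus_word_def lookup_single when_def)
  qed (auto simp: distrib_right lookup_add)
qed

lemma annI_V: "annI = range (\<lambda>v :: 'k::comm_ring_1 V. v * e0)"
proof safe
  fix x :: "'k V" assume "x \<in> annI"
  then show "x \<in> range (\<lambda>v. v * e0)"
  proof induction
    case (left_ideal_gen x)
    then have "x = 1 * e0" by (auto simp: ann_word_def killed_gen_def e0_def)
    then show ?case by blast
  next
    case left_ideal_zero
    have "0 = 0 * (e0 :: 'k V)" by simp
    then show ?case by blast
  next
    case (left_ideal_add x y)
    then obtain u v where "x = u * e0" "y = v * e0" by blast
    then have "x + y = (u + v) * e0" by (simp add: distrib_right)
    then show ?case by blast
  next
    case (left_ideal_mult x a)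
    then obtain u where "x = u * e0" by blast
    then have "a * x = (a * u) * e0" by (simp add: mult.assoc)
    then show ?case by blast
  qed
next
  fix v :: "'k V"
  show "v * e0 \<in> annI"
    by (intro left_ideal_mult left_ideal_gen) (simp add: e0_def ann_word_def killed_gen_def)
qed

text \<open>Membership in W kills the coefficients of words ending in \<open>E0\<close>, membership
  in V e_0 kills all others.\<close>

lemma W_Int_annI:
  assumes "x \<in> W" "x \<in> annI"
  shows "x = (0 :: 'k::comm_ring_1 V)"
proof -
  obtain c v where x1: "x = cst c + v * e1" using assms(1) by (auto simp: W_def)
  obtain b where x2: "x = b * e0" using assms(2) by (auto simp: annI_V)
  note eqs = x1[unfolded e1_def] x2[unfolded e0_def]
  have "Poly_Mapping.lookup x (Word ls) = 0" for ls
  proof (cases ls rule: rev_cases)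
    case Nil
    then show ?thesis by (simp add: eqs(2) lookup_mult_letter(2))
  next
    case (snoc us g)
    then show ?thesis
    proof (cases g)
      case E0
      then show ?thesis
        unfolding eqs(1) by (simp add: lookup_add lookup_mult_letter(1) snoc lookup_single when_def zero_word_def)
    next
      case E1
      then show ?thesis unfolding eqs(2) by (simp add: lookup_mult_letter(1) snoc)
    qed
  qed
  then show ?thesis by (metis poly_mapping_eqI word.exhaust lookup_zero)
qed

lemma W_closed:
  assumes "x \<in> W" "y \<in> (W :: 'k::comm_ring_1 V set)"
  shows "x + y \<in> W" "x - y \<in> W" "x * y \<in> W"
proof -
  obtain c v d u where xy: "x = cst c + v * e1" "y = cst d + u * e1" using assms by (auto simp: W_def)
  have "x + y = cst (c + d) + (v + u) * e1" "x - y = cst (c - d) + (v - u) * e1"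
    by (simp_all add: xy single_add single_diff algebra_simps)
  moreover have "x * y = cst (c * d) + (cst d * v + x * u) * e1"
    by (simp add: xy distrib_left distrib_right mult_single mult.assoc cst_central[of d] add.assoc)
  ultimately show "x + y \<in> W" "x - y \<in> W" "x * y \<in> W" unfolding W_def by blast+
qed

lemma Y_eval_in_W: "Y_eval x \<in> (W :: 'k::comm_ring_1 V set)"
proof (induction x rule: free_algebra_induct)
  case (cst c)
  have "Y_eval (cst c) = cst c + 0 * (e1 :: 'k V)"
    using Y_eval_single[of "[]" c] by (simp add: zero_word_def)
  then show ?case unfolding W_def by blast
next
  case (gen n)
  have "Y_eval (mon (Word [n])) = cst 0 + (- (e0 ^ n)) * (e1 :: 'k V)"
    unfolding Y_eval_def mlift_word_prod_gen[OF ring_hom_cst] by (simp add: ygen_def)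
  then show ?case unfolding W_def by blast
qed (simp_all add: ring_hom_simps[OF ring_hom_Y_eval] W_closed)

text \<open>The coproduct in free generators: \<open>\<Delta>W (Y_eval x)\<close> equals
  \<open>\<Delta>Y x\<close> by injectivity of \<open>Y_eval\<close>.\<close>

definition \<Delta>Y :: "(nat word \<Rightarrow>\<^sub>0 'k) \<Rightarrow> 'k::comm_ring_1 V2"
  where "\<Delta>Y = mlift cst (word_prod (\<lambda>n. \<Delta>y (Suc n)))"

lemma ring_hom_\<Delta>Y: "ring_hom \<Delta>Y"
  unfolding \<Delta>Y_def by (intro ring_hom_mlift_cst word_prod_simps)

text \<open>The class of \<open>b * e0\<close> vanishes, and \<open>W_Int_annI\<close> makes
  \<open>Y_eval x\<close> the only candidate for the definite description in
  \<open>\<Delta>M\<close>.\<close>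

lemma \<Delta>M_eq: "\<Delta>M (qclass (Y_eval x + b * e0)) = qclass (\<Delta>Y x :: 'k::comm_ring_1 V2)"
proof -
  have "(THE w. w \<in> W \<and> w \<rhd> one_DR = qclass (Y_eval x + b * e0)) = (Y_eval x :: 'k V)"
  proof (rule the_equality)
    have "qclass (b * e0) = 0" for b :: "'k V"
      unfolding e0_def by (rule qclass_killed) (simp add: ann_word_def killed_gen_def)
    then show "Y_eval x \<in> W \<and> Y_eval x \<rhd> one_DR = qclass (Y_eval x + b * e0)"
      by (simp add: Y_eval_in_W one_DR_def qclass_simps(1) qclass_simps(2)[symmetric])
    fix w :: "'k V" assume w: "w \<in> W \<and> w \<rhd> one_DR = qclass (Y_eval x + b * e0)"
    then have "qclass w = qclass (Y_eval x)"
      using \<open>qclass (b * e0) = 0\<close> by (simp add: one_DR_def qclass_simps(1) qclass_simps(2)[symmetric])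
    then have "w - Y_eval x \<in> annI" by (simp add: qclass_eq_iff)
    with w have "w - Y_eval x = 0" by (intro W_Int_annI W_closed Y_eval_in_W) auto
    then show "w = Y_eval x" by simp
  qed
  then show ?thesis
    by (simp add: \<Delta>M_def \<Delta>W_def the_inv_f_f[OF inj_Y_eval] \<Delta>Y_def[symmetric] one_DR2_eq qclass_simps(2)[symmetric])
qed

lemma V_decomp: obtains x b where "a = Y_eval x + b * (e0 :: 'k::comm_ring_1 V)"
proof -
  have "\<exists>x b. a = Y_eval x + b * e0"
  proof (induction a rule: poly_mapping_add_induct)
    case zero
    have "0 = Y_eval 0 + 0 * (e0 :: 'k V)" by (simp add: ring_hom_simps[OF ring_hom_Y_eval])
    then show ?case by blast
  next
    case (single w c)
    obtain ls where w: "w = Word ls" by (cases w)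
    show ?case
    proof (cases ls rule: word_cases)
      case (1 us)
      then have "Poly_Mapping.single w c = Y_eval 0 + Poly_Mapping.single (Word us) c * e0"
        by (simp add: w e0_def mult_single plus_word_def ring_hom_simps[OF ring_hom_Y_eval])
      then show ?thesis by blast
    next
      case (2 ns)
      \<comment> \<open>The sign cancels the one produced by \<open>Y_eval_single\<close>.\<close>
      then have "Poly_Mapping.single w c = Y_eval (Poly_Mapping.single (Word ns) ((- 1) ^ length ns * c)) + 0 * e0"
        by (simp add: w Y_eval_single mult.assoc[symmetric] power_add[symmetric])
      then show ?thesis by blast
    qed
  next
    case (add a a')
    then obtain x b x' b' where "a = Y_eval x + b * e0" "a' = Y_eval x' + b' * e0" by blast
    then have "a + a' = Y_eval (x + x') + (b + b') * e0"
      by (simp add: ring_hom_simps[OF ring_hom_Y_eval] distrib_right)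
    then show ?case by blast
  qed
  then show thesis using that by blast
qed

lemma \<Delta>M_add: "\<Delta>M (m + n) = \<Delta>M m + \<Delta>M (n :: 'k::comm_ring_1 M)"
proof -
  obtain a b :: "'k V" where ab: "m = qclass a" "n = qclass b" using qclass_surj by metis
  obtain x u where a: "a = Y_eval x + u * e0" by (rule V_decomp)
  obtain y v where b: "b = Y_eval y + v * e0" by (rule V_decomp)
  have "a + b = Y_eval (x + y) + (u + v) * e0"
    by (simp add: a b ring_hom_simps[OF ring_hom_Y_eval] distrib_right)
  then have "\<Delta>M (m + n) = qclass (\<Delta>Y (x + y))"
    unfolding ab qclass_simps(1)[symmetric] by (simp only: \<Delta>M_eq)
  then show ?thesis by (simp only: ab a b \<Delta>M_eq ring_hom_simps(2)[OF ring_hom_\<Delta>Y] qclass_simps(1)[of "\<Delta>Y x" "\<Delta>Y y"])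
qed


section \<open>The two compositions coincide\<close>

text \<open>With E as in the overview, products preserve the relation since c d E = c E \<Delta>(y)
  = E \<Delta>(x) \<Delta>(y). Written with E on both sides, it stays inside
  \<open>V2\<close>.\<close>

lemma row1_rho_Y_eval:
  assumes two: "(2 :: 'k::comm_ring_1) dvd 1"
  shows "\<exists>c. row_mult row1 (rho (Y_eval x :: 'k V)) = (\<chi> j. c * row1 $ j) \<and>
    c * tens e1 e1 = tens e1 e1 * \<Delta>Y x"
proof (induction x rule: free_algebra_induct)
  case (cst c)
  have "Y_eval (cst c) = (cst c :: 'k V)" "\<Delta>Y (cst c) = cst c"
    by (simp_all add: Y_eval_def \<Delta>Y_def mlift_single[OF ring_hom_cst] word_prod_simps)
  then show ?case
    by (intro exI[of _ "cst c"]) (simp add: rho_cst[OF two] row_mult_mat_cst cst_central[of c "tens e1 e1"])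
next
  case (gen n)
  show ?case
    using row1_rho_ygen[OF two, of n] row_coeff_conjugate[of n, where 'k = 'k]
    unfolding Y_eval_def \<Delta>Y_def mlift_word_prod_gen[OF ring_hom_cst] by blast
next
  case (add x y)
  then obtain c d where "row_mult row1 (rho (Y_eval x :: 'k V)) = (\<chi> j. c * row1 $ j)"
    "c * tens e1 e1 = tens e1 e1 * \<Delta>Y x"
    "row_mult row1 (rho (Y_eval y :: 'k V)) = (\<chi> j. d * row1 $ j)"
    "d * tens e1 e1 = tens e1 e1 * \<Delta>Y y" by blast
  then show ?case
    by (intro exI[of _ "c + d"])
      (simp add: ring_hom_simps[OF ring_hom_Y_eval] ring_hom_simps[OF ring_hom_\<Delta>Y] rho_add[OF two]
        row_mult_add distrib_left distrib_right vec_eq_iff)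
next
  case (mult x y)
  then obtain c d where *: "row_mult row1 (rho (Y_eval x :: 'k V)) = (\<chi> j. c * row1 $ j)"
    "c * tens e1 e1 = tens e1 e1 * \<Delta>Y x"
    "row_mult row1 (rho (Y_eval y :: 'k V)) = (\<chi> j. d * row1 $ j)"
    "d * tens e1 e1 = tens e1 e1 * \<Delta>Y y" by blast
  have "c * d * tens e1 e1 = c * tens e1 e1 * \<Delta>Y y" by (simp only: mult.assoc *(4))
  also have "\<dots> = tens e1 e1 * \<Delta>Y (x * y)"
    by (simp only: *(2) mult.assoc ring_hom_simps(3)[OF ring_hom_\<Delta>Y])
  finally show ?case
    by (intro exI[of _ "c * d"])
      (simp add: ring_hom_simps[OF ring_hom_Y_eval] rho_mult[OF two] row_mult_assoc * row_mult_smult mult.assoc)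
qed

lemma coproduct_eq_rowcol_rho:
  fixes a :: "'k::comm_ring_1 V"
  assumes two: "(2 :: 'k) dvd 1"
  shows "loc_M2 (\<Delta>M (a \<rhd> one_DR)) = rowcol (rho a)"
proof -
  obtain x b where a: "a = Y_eval x + b * e0" by (rule V_decomp)
  obtain c where c: "row_mult row1 (rho (Y_eval x :: 'k V)) = (\<chi> j. c * row1 $ j)"
    "c * tens e1 e1 = tens e1 e1 * \<Delta>Y x"
    using row1_rho_Y_eval[OF two] by blast
  obtain z where z: "row_col (row_mult row1 (rho (b * e0))) = z * inr e0"
    unfolding rho_mult[OF two] row_mult_assoc using row_col_rho_e0[OF two] by blast
  \<comment> \<open>This monomial is f_0, one of the generators killed in
    \<open>Mloc2\<close>.\<close>
  have ann: "loc_word2 (0, Word [E0]) \<in> ann"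
    using loc_word2_ann by (rule subsetD) (auto simp: ann_prod_def ann_word_def killed_gen_def)
  \<comment> \<open>The first summand comes from the W-part of \<open>a\<close>, with c E rewritten
    as E \<Delta>; the second comes from \<open>b * e0\<close> and is a left multiple of
    f_0.\<close>
  have "rowcol (rho a) = qclass (e1f1_inv * (loc_V2 (tens e1 e1) * loc_V2 (\<Delta>Y x))
    + e1f1_inv * loc_V2 z * mon (loc_word2 (0, Word [E0])))"
    by (simp add: rowcol_eq a rho_add[OF two] row_mult_add row_col_add c z row_col_smult row_col_row1
        ring_hom_simps[OF ring_hom_loc_V2] distrib_left mult.assoc)
      (simp add: loc_V2_def inr_def e0_def)
  also have "\<dots> = qclass (loc_V2 (\<Delta>Y x))"
    by (simp only: e1f1_inv_cancel qclass_simps(1) qclass_killed[OF ann] add_0_right)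
  also have "\<dots> = loc_M2 (\<Delta>M (a \<rhd> one_DR))"
    by (simp add: one_DR_def qclass_simps(2)[symmetric] a \<Delta>M_eq loc_M2_qclass)
  finally show ?thesis ..
qed


section \<open>Degrees\<close>

lemma deg_part_zero: "0 \<in> deg_part n"
  by (simp add: deg_part_def)

lemma deg_part_single: "mdeg w = n \<Longrightarrow> Poly_Mapping.single w c \<in> deg_part n"
  by (simp add: deg_part_def)

lemma deg_part_add: "x \<in> deg_part n \<Longrightarrow> y \<in> deg_part n \<Longrightarrow> x + y \<in> deg_part n"
  using keys_add[of x y] by (auto simp: deg_part_def)

lemma deg_part_uminus: "x \<in> deg_part n \<Longrightarrow> - x \<in> deg_part n"
  by (simp add: deg_part_def in_keys_iff)

lemma deg_part_mult: "x \<in> deg_part m \<Longrightarrow> y \<in> deg_part n \<Longrightarrow> x * y \<in> deg_part (m + n)"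
  using keys_mult[of x y] by (fastforce simp: deg_part_def mdeg_add)

lemma deg_part_sum: "(\<And>i. i \<in> S \<Longrightarrow> f i \<in> deg_part n) \<Longrightarrow> sum f S \<in> deg_part n"
  by (induction S rule: infinite_finite_induct) (auto simp: deg_part_zero deg_part_add)

lemma deg_part_induct [consumes 1, case_names zero single add]:
  assumes x: "x \<in> deg_part n" and zero: "S 0"
    and single: "\<And>w c. mdeg w = n \<Longrightarrow> S (Poly_Mapping.single w c)"
    and add: "\<And>x y. S x \<Longrightarrow> S y \<Longrightarrow> S (x + y)"
  shows "S (x :: 'm::graded_monoid \<Rightarrow>\<^sub>0 'k::comm_ring_1)"
proof -
  have "S (\<Sum>w\<in>K. Poly_Mapping.single w (Poly_Mapping.lookup x w))" if "K \<subseteq> Poly_Mapping.keys x" for K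
    using finite_subset[OF that finite_keys] that x
    by (induction K rule: finite_induct) (auto simp: deg_part_def zero intro!: add single)
  moreover have "(\<Sum>w\<in>Poly_Mapping.keys x. Poly_Mapping.single w (Poly_Mapping.lookup x w)) = x"
    by (rule poly_mapping_eqI) (simp add: lookup_sum lookup_single when_def in_keys_iff)
  ultimately show ?thesis by (metis order_refl)
qed

lemma inl_single: "inl (Poly_Mapping.single w c) = Poly_Mapping.single (w, 0) c"
  by (simp add: inl_def)

lemma deg_part_inl: "x \<in> deg_part n \<Longrightarrow> inl x \<in> deg_part n"
  by (induction rule: deg_part_induct)
    (simp_all add: ring_hom_simps[OF ring_hom_inl] deg_part_zero deg_part_add inl_single
      deg_part_single mdeg_prod_def mdeg_zero)

lemma inr_single: "inr (Poly_Mapping.single w c) = Poly_Mapping.single (0, w) c"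
  by (simp add: inr_def)

lemma deg_part_inr: "x \<in> deg_part n \<Longrightarrow> inr x \<in> deg_part n"
  by (induction rule: deg_part_induct)
    (simp_all add: ring_hom_simps[OF ring_hom_inr] deg_part_zero deg_part_add inr_single
      deg_part_single mdeg_prod_def mdeg_zero)

lemma deg_part_tens: "x \<in> deg_part m \<Longrightarrow> y \<in> deg_part n \<Longrightarrow> tens x y \<in> deg_part (m + n)"
  unfolding tens_def by (intro deg_part_mult deg_part_inl deg_part_inr)

lemma deg_part_e: "e0 \<in> deg_part 1" "e1 \<in> deg_part 1"
  by (simp_all add: e0_def e1_def deg_part_single mdeg_word_def)

lemma deg_part_ygen: "n > 0 \<Longrightarrow> ygen n \<in> deg_part (int n)"
  by (cases n) (simp_all add: ygen_Suc deg_part_single mdeg_word_def)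

lemma deg_part_\<Delta>y: "\<Delta>y (Suc n) \<in> deg_part (int (Suc n))"
proof -
  have "tens (ygen k) (ygen (Suc n - k)) \<in> deg_part (int (Suc n))" if "k \<in> {1..n}" for k
    using deg_part_tens[OF deg_part_ygen[of k] deg_part_ygen[of "Suc n - k"]] that
    by (simp add: of_nat_diff)
  then show ?thesis
    unfolding \<Delta>y_def tens_inl_inr
    by (intro deg_part_add deg_part_sum deg_part_inl deg_part_inr deg_part_ygen) simp_all
qed

text \<open>Letter n contributes n + 1, which is both the degree of \<open>\<Delta>y (Suc n)\<close>
  and the length of its block in \<open>y_word\<close>.\<close>

lemma deg_part_\<Delta>Y_single: "\<Delta>Y (Poly_Mapping.single (Word ns) c) \<in> deg_part (int (length (y_word ns)))"
proof (induction ns)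
  case Nil
  show ?case
    by (simp add: \<Delta>Y_def mlift_single[OF ring_hom_cst] word_prod_def deg_part_single mdeg_zero)
next
  case (Cons n ns)
  have "\<Delta>Y (Poly_Mapping.single (Word (n # ns)) c) = \<Delta>y (Suc n) * \<Delta>Y (Poly_Mapping.single (Word ns) c)"
    unfolding \<Delta>Y_def by (rule free_mlift_Cons)
  then show ?case using deg_part_mult[OF deg_part_\<Delta>y[of n] Cons] by (simp add: algebra_simps)
qed

lemma qdeg_part_add: "x \<in> qdeg_part n \<Longrightarrow> y \<in> qdeg_part n \<Longrightarrow> x + y \<in> qdeg_part n"
  by (auto simp: qdeg_part_def qclass_simps(1)[symmetric] intro!: imageI deg_part_add)

text \<open>By additivity it suffices to treat words: those ending in \<open>E0\<close> are sent to
  0, the others are of the form \<open>y_word ns\<close>.\<close>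

lemma degree0_\<Delta>M: "degree0 qdeg_part qdeg_part (\<Delta>M :: 'k::comm_ring_1 M \<Rightarrow> 'k M2)"
proof -
  have zero: "\<Delta>M 0 = (0 :: 'k M2)" using \<Delta>M_add[of 0 0] by simp
  have "\<Delta>M (qclass a) \<in> qdeg_part n" if "a \<in> deg_part n" for a :: "'k V" and n
    using that
  proof (induction rule: deg_part_induct)
    case zero
    show ?case unfolding qclass_zero \<open>\<Delta>M 0 = 0\<close> qdeg_part_def
      by (rule image_eqI[OF _ deg_part_zero]) (rule qclass_zero[symmetric])
  next
    case (single w c)
    obtain ls where w: "w = Word ls" by (cases w)
    show ?case
    proof (cases ls rule: word_cases)
      case (1 us)
      then have "Poly_Mapping.single w c = Y_eval 0 + Poly_Mapping.single (Word us) c * e0"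
        by (simp add: w e0_def mult_single plus_word_def ring_hom_simps[OF ring_hom_Y_eval])
      then have "\<Delta>M (qclass (Poly_Mapping.single w c)) = qclass (\<Delta>Y 0)" by (simp only: \<Delta>M_eq)
      then show ?thesis
        unfolding ring_hom_simps(4)[OF ring_hom_\<Delta>Y] by (auto simp: qdeg_part_def intro: deg_part_zero)
    next
      case (2 ns)
      then have "Poly_Mapping.single w c = Y_eval (Poly_Mapping.single (Word ns) ((- 1) ^ length ns * c)) + 0 * e0"
        by (simp add: w Y_eval_single mult.assoc[symmetric] power_add[symmetric])
      then have "\<Delta>M (qclass (Poly_Mapping.single w c))
        = qclass (\<Delta>Y (Poly_Mapping.single (Word ns) ((- 1) ^ length ns * c)))" by (simp only: \<Delta>M_eq)
      then show ?thesis
        using deg_part_\<Delta>Y_single single by (auto simp: qdeg_part_def mdeg_word_def w 2)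
    qed
  next
    case (add x y)
    then show ?case by (simp add: qclass_simps \<Delta>M_add qdeg_part_add)
  qed
  then show ?thesis by (auto simp: degree0_def qdeg_part_def[of _, where 'm = "gen word"])
qed

lemma mat_deg_part_mult:
  "A \<in> mat_deg_part m \<Longrightarrow> B \<in> mat_deg_part n \<Longrightarrow> A ** B \<in> mat_deg_part (m + n)"
  by (auto simp: mat_deg_part_def matrix_matrix_mult_def intro!: deg_part_sum deg_part_mult)

text \<open>\<open>rho\<close> is multiplicative, and the entries of \<open>rho e0\<close> and
  \<open>rho e1\<close> are homogeneous of degree 1.\<close>

lemma degree0_rho:
  assumes two: "(2 :: 'k::comm_ring_1) dvd 1"
  shows "degree0 deg_part mat_deg_part (rho :: 'k V \<Rightarrow> 'k V2^3^3)"
proof -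
  note inl_e = deg_part_inl[OF deg_part_e(1)] deg_part_inl[OF deg_part_e(2)]
  note inr_e = deg_part_inr[OF deg_part_e(1)] deg_part_inr[OF deg_part_e(2)]
  have sub: "x - y \<in> deg_part n" if "x \<in> deg_part n" "y \<in> deg_part n" for x y :: "'k V2" and n
    using deg_part_add[OF that(1) deg_part_uminus[OF that(2)]] by simp
  have g: "rho (mon (Word [g]) :: 'k V) \<in> mat_deg_part 1" for g
  proof (cases g)
    case E0
    then show ?thesis unfolding E0 e0_def[symmetric] rho_e0[OF two]
      by (simp add: mat_deg_part_def forall_3 inl_e inr_e deg_part_zero deg_part_add deg_part_uminus sub)
  next
    case E1
    then show ?thesis unfolding E1 e1_def[symmetric] rho_e1[OF two]
      by (simp add: mat_deg_part_def forall_3 inl_e inr_e deg_part_zero deg_part_uminus)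
  qed
  have word: "rho (Poly_Mapping.single (Word gs) c :: 'k V) \<in> mat_deg_part (int (length gs))" for gs c
  proof (induction gs)
    case Nil
    show ?case
      using rho_cst[OF two, of c]
      by (simp add: zero_word_def mat_deg_part_def mat_def deg_part_zero deg_part_single mdeg_zero)
  next
    case (Cons g gs)
    have "Poly_Mapping.single (Word (g # gs)) c = mon (Word [g]) * Poly_Mapping.single (Word gs) c"
      by (simp add: mult_single plus_word_def)
    then show ?case using mat_deg_part_mult[OF g Cons] by (simp add: rho_mult[OF two])
  qed
  have "rho a \<in> mat_deg_part n" if "a \<in> deg_part n" for a :: "'k V" and n
    using that
  proof (induction rule: deg_part_induct)
    case zero
    show ?case using word[of "[]" 0] rho_cst[OF two, of 0] by (simp add: mat_deg_part_def mat_def deg_part_zero)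
  next
    case (single w c)
    then show ?case using word[of "letters w" c] by (simp add: mdeg_word_def)
  next
    case (add x y)
    then show ?case by (simp add: rho_add[OF two] mat_deg_part_def deg_part_add)
  qed
  then show ?thesis by (auto simp: degree0_def)
qed

section \<open>Degrees in the localized modules\<close>

lemma mdeg_loc_word: "mdeg (loc_word w) = mdeg w"
proof -
  have "sum_list (map (\<lambda>g. case g of L0 \<Rightarrow> 1 | L1 \<Rightarrow> 1 | L1inv \<Rightarrow> - 1)
      (map (\<lambda>g. case g of E0 \<Rightarrow> L0 | E1 \<Rightarrow> L1) gs)) = int (length gs)" for gs
    by (induction gs) (auto split: gen.split)
  then show ?thesis by (simp add: loc_word_def mdeg_lword.abs_eq mdeg_word_def)
qed

lemma mdeg_lletter_L1inv: "mdeg (lletter L1inv) = - 1"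
  by transfer simp

lemma qtens_qclass: "qtens (qclass x) (qclass y) = qclass (tens x y)"
  by transfer (simp add: left_ideal_zero)

lemma Mloc2_ge_part_single:
  assumes "mdeg a \<ge> - 1" "mdeg b \<ge> - 1" "mdeg a + mdeg b = n"
  shows "qclass (Poly_Mapping.single (a, b) c) \<in> Mloc2_ge_part n"
proof -
  have *: "qclass (Poly_Mapping.single (a, b) c) = qscale c (qtens (qclass (mon a)) (qclass (mon b)))"
    unfolding qtens_qclass tens_single qclass_simps(3)[symmetric] by (simp add: mult_single)
  have "qclass (mon a) \<in> Mloc_ge_part (mdeg a)" "qclass (mon b) \<in> Mloc_ge_part (mdeg b)"
    using assms(1,2) by (auto simp: Mloc_ge_part_def qdeg_part_def intro!: imageI deg_part_single)
  then show ?thesis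
    unfolding * Mloc2_ge_part_def using assms(3)
    by (intro module.span_scale[OF module_qscale] module.span_base[OF module_qscale]) blast
qed

lemma Mloc2_ge_part_subset: "Mloc2_ge_part n \<subseteq> Mloc2_ge"
  unfolding Mloc2_ge_part_def Mloc2_ge_def by (rule module.span_mono[OF module_qscale]) blast

lemma Mloc2_ge_part_sum: "(\<And>i. i \<in> S \<Longrightarrow> f i \<in> Mloc2_ge_part n) \<Longrightarrow> sum f S \<in> Mloc2_ge_part n"
  unfolding Mloc2_ge_part_def by (rule module.span_sum[OF module_qscale])

lemma Mloc2_ge_sum: "(\<And>i. i \<in> S \<Longrightarrow> f i \<in> Mloc2_ge) \<Longrightarrow> sum f S \<in> Mloc2_ge"
  unfolding Mloc2_ge_def by (rule module.span_sum[OF module_qscale])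

text \<open>Both targets are spans, hence closed under sums, so membership can be tested on
  monomials.\<close>

lemma linear_into_Mloc2_ge:
  fixes L :: "'k::comm_ring_1 V2 \<Rightarrow> 'k Mloc2"
  assumes add: "\<And>x y. L (x + y) = L x + L y"
    and single: "\<And>w c. L (Poly_Mapping.single w c) \<in> Mloc2_ge_part (mdeg w)"
  shows "L x \<in> Mloc2_ge" "x \<in> deg_part n \<Longrightarrow> L x \<in> Mloc2_ge_part n"
proof -
  have zero: "L 0 = 0" using add[of 0 0] by simp
  show "L x \<in> Mloc2_ge"
  proof (induction x rule: poly_mapping_add_induct)
    case (single w c)
    show ?case using assms(2) Mloc2_ge_part_subset by blast
  qed (auto simp: zero add Mloc2_ge_def module.span_zero[OF module_qscale] module.span_add[OF module_qscale])
  show "L x \<in> Mloc2_ge_part n" if "x \<in> deg_part n"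
    using that
  proof (induction rule: deg_part_induct)
    case (single w c)
    then show ?case using assms(2) by blast
  qed (auto simp: zero add Mloc2_ge_part_def module.span_zero[OF module_qscale] module.span_add[OF module_qscale])
qed

lemma loc_M2_add: "loc_M2 (m + n) = loc_M2 m + loc_M2 (n :: 'k::comm_ring_1 M2)"
proof -
  obtain x y :: "'k V2" where "m = qclass x" "n = qclass y" using qclass_surj by metis
  then show ?thesis
    by (simp only: qclass_simps(1)[symmetric] loc_M2_qclass ring_hom_simps(2)[OF ring_hom_loc_V2])
qed

text \<open>Localization preserves the degree in each factor, and words have nonnegative
  degree.\<close>

lemma loc_M2_into_Mloc2_ge:
  fixes x :: "'k::comm_ring_1 V2"
  shows "loc_M2 (qclass x) \<in> Mloc2_ge" "x \<in> deg_part n \<Longrightarrow> loc_M2 (qclass x) \<in> Mloc2_ge_part n"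
proof -
  have "loc_M2 (qclass (Poly_Mapping.single w c)) \<in> (Mloc2_ge_part (mdeg w) :: 'k Mloc2 set)" for w c
    by (cases w) (auto simp: loc_M2_qclass loc_V2_def loc_word2_def mdeg_loc_word mdeg_prod_def mdeg_word_def
        intro!: Mloc2_ge_part_single)
  note * = linear_into_Mloc2_ge[of "\<lambda>x. loc_M2 (qclass x)", OF _ this]
  show "loc_M2 (qclass x) \<in> Mloc2_ge" "x \<in> deg_part n \<Longrightarrow> loc_M2 (qclass x) \<in> Mloc2_ge_part n"
    by (rule *; simp add: loc_M2_add qclass_simps(1))+
qed

text \<open>The inverse lowers the degree by one in each tensor factor, so both stay at least -1. In
  total, row and column contribute 1 each and the inverse -2.\<close>

lemma rowcol_term_into_Mloc2_ge:
  fixes x :: "'k::comm_ring_1 V2" and i j :: 3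
  defines "L \<equiv> \<lambda>x. qclass (e1f1_inv * loc_V2 (row1 $ i * x * colV $ j)) :: 'k Mloc2"
  shows "L x \<in> Mloc2_ge" "x \<in> deg_part n \<Longrightarrow> L x \<in> Mloc2_ge_part n"
proof -
  have "\<forall>i. \<exists>p q d. (row1 $ i :: 'k V2) = Poly_Mapping.single (p, q) d \<and> mdeg p + mdeg q = 1"
  proof -
    have "mdeg (Word [E1]) + mdeg (0 :: gen word) = 1" "mdeg (0 :: gen word) + mdeg (Word [E1]) = 1"
      by (simp_all add: mdeg_zero mdeg_word_def[of "Word [E1]"])
    \<comment> \<open>The zero entry is written as a monomial of degree 1 with coefficient 0, so
      that one degree count covers all three entries.\<close>
    moreover have "(row1 $ 1 :: 'k V2) = Poly_Mapping.single (Word [E1], 0) 1"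
      "(row1 $ 2 :: 'k V2) = Poly_Mapping.single (0, Word [E1]) (- 1)"
      "(row1 $ 3 :: 'k V2) = Poly_Mapping.single (0, Word [E1]) 0"
      by (simp_all add: row1_def tens_inl_inr inl_def inr_def e1_def single_uminus)
    ultimately show ?thesis unfolding forall_3 by blast
  qed
  then obtain p q d where row: "(row1 $ i :: 'k V2) = Poly_Mapping.single (p, q) d" "mdeg p + mdeg q = 1"
    by blast
  have "\<forall>j. \<exists>d'. (colV $ j :: 'k V2) = Poly_Mapping.single (Word [E1], 0) d'"
  proof -
    have "(colV $ 1 :: 'k V2) = Poly_Mapping.single (Word [E1], 0) 0"
      "(colV $ 2 :: 'k V2) = Poly_Mapping.single (Word [E1], 0) (- 1)"
      "(colV $ 3 :: 'k V2) = Poly_Mapping.single (Word [E1], 0) 1"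
      by (simp_all add: colV_def inl_def e1_def single_uminus)
    then show ?thesis unfolding forall_3 by blast
  qed
  then obtain d' where col: "(colV $ j :: 'k V2) = Poly_Mapping.single (Word [E1], 0) d'" by blast
  have "L (Poly_Mapping.single w c) \<in> Mloc2_ge_part (mdeg w)" for w c
  proof -
    obtain u v where w: "w = (u, v)" by (cases w)
    have "L (Poly_Mapping.single w c) = qclass (Poly_Mapping.single
      (lletter L1inv + loc_word (p + u + Word [E1]), lletter L1inv + loc_word (q + v)) (d * c * d'))"
      by (simp add: L_def w row(1) col mult_single e1f1_inv_def tens_single loc_V2_def loc_word2_def)
    also have "\<dots> \<in> Mloc2_ge_part (mdeg w)"
      using row(2)
      by (intro Mloc2_ge_part_single)
        (simp_all add: w mdeg_prod_def mdeg_add mdeg_loc_word mdeg_lletter_L1inv, simp_all add: mdeg_word_def)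
    finally show ?thesis .
  qed
  note * = linear_into_Mloc2_ge[of L, OF _ this]
  show "L x \<in> Mloc2_ge" "x \<in> deg_part n \<Longrightarrow> L x \<in> Mloc2_ge_part n"
    by (rule *; simp add: L_def distrib_left distrib_right ring_hom_simps[OF ring_hom_loc_V2] qclass_simps(1))+
qed

text \<open>The hypothesis makes every positive integer a unit of \<open>'k\<close>, which is to say
  that \<open>'k\<close> is a Q-algebra.\<close>

theorem proposition6p9:
  assumes "\<forall>n::nat. n > 0 \<longrightarrow> (of_nat n :: 'k::comm_ring_1) dvd 1"
  shows "(\<forall>a :: 'k V. loc_M2 (\<Delta>M (a \<rhd> one_DR)) = rowcol (rho a))
    \<and> (rowcol \<circ> rho :: 'k V \<Rightarrow> 'k Mloc2) = loc_M2 \<circ> \<Delta>M \<circ> (\<lambda>a. a \<rhd> one_DR)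
    \<and> (\<forall>m :: 'k V2^3^3. rowcol m \<in> Mloc2_ge)
    \<and> (\<forall>m :: 'k M2. loc_M2 m \<in> Mloc2_ge)
    \<and> degree0 deg_part mat_deg_part (rho :: 'k V \<Rightarrow> 'k V2^3^3)
    \<and> degree0 mat_deg_part Mloc2_ge_part (rowcol :: 'k V2^3^3 \<Rightarrow> 'k Mloc2)
    \<and> degree0 deg_part qdeg_part (\<lambda>a :: 'k V. a \<rhd> one_DR)
    \<and> degree0 qdeg_part qdeg_part (\<Delta>M :: 'k M \<Rightarrow> 'k M2)
    \<and> degree0 qdeg_part Mloc2_ge_part (loc_M2 :: 'k M2 \<Rightarrow> 'k Mloc2)"
proof -
  \<comment> \<open>Invertibility of 2 serves to solve the linear relations for e_34 and
    e_14.\<close>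
  have two: "(2 :: 'k) dvd 1" using assms[rule_format, of 2] by simp
  have main: "loc_M2 (\<Delta>M (a \<rhd> one_DR)) = rowcol (rho a)" for a :: "'k V"
    by (rule coproduct_eq_rowcol_rho[OF two])
  show ?thesis
  proof (intro conjI allI)
    show "(rowcol \<circ> rho :: 'k V \<Rightarrow> 'k Mloc2) = loc_M2 \<circ> \<Delta>M \<circ> (\<lambda>a. a \<rhd> one_DR)"
      by (simp add: fun_eq_iff main)
    show "rowcol m \<in> Mloc2_ge" for m :: "'k V2^3^3"
      unfolding rowcol_sum by (intro Mloc2_ge_sum rowcol_term_into_Mloc2_ge)
    show "loc_M2 m \<in> Mloc2_ge" for m :: "'k M2"
      using qclass_surj[of m] loc_M2_into_Mloc2_ge(1) by blast
    show "degree0 mat_deg_part Mloc2_ge_part (rowcol :: 'k V2^3^3 \<Rightarrow> 'k Mloc2)"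
      unfolding degree0_def rowcol_sum
      by (auto simp: mat_deg_part_def intro!: Mloc2_ge_part_sum rowcol_term_into_Mloc2_ge)
    show "degree0 deg_part qdeg_part (\<lambda>a :: 'k V. a \<rhd> one_DR)"
      by (auto simp: degree0_def one_DR_def qdeg_part_def qclass_simps(2)[symmetric])
    show "degree0 qdeg_part Mloc2_ge_part (loc_M2 :: 'k M2 \<Rightarrow> 'k Mloc2)"
      by (auto simp: degree0_def qdeg_part_def loc_M2_into_Mloc2_ge)
  qed (rule main degree0_rho[OF two] degree0_\<Delta>M)+
qed

end
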